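(* For every integer $m \ge 0$, the Gabor system $\mathcal{G}\left(h_{4m+2}, \mathbb{Z}^2 \cup (\mathbb{Z}+\tfrac{1}{2})^2\right)$ is not a Gabor frame for $L^2(\mathbb{R})$.
   Context: For $x,\omega \in \mathbb{R}$ define the unitary operators on $L^2(\mathbb{R})$ of translation $\mathcal{T}_x f(t) = f(t-x)$ and modulation $\mathcal{M}_\omega f(t) = e^{2\pi i \omega t} f(t)$, and for $z=(x,\omega)\in\mathbb{R}^2$ the time-frequency shift $\pi(z) = \mathcal{M}_\omega \mathcal{T}_x$. For $g \in L^2(\mathbb{R})$ and a discrete set $\Lambda \subset \mathbb{R}^2$, the Gabor system is $\mathcal{G}(g,\Lambda) = \{\pi(\lambda) g \mid \lambda \in \Lambda\}$. It is a (Gabor) frame for $L^2(\mathbb{R})$ if and only if there exist constants $0 < A \le B < \infty$ such that for all $f \in L^2(\mathbb{R})$ $$A \lVert f\rVert_2^2 \le \sum_{\lambda \in \Lambda} |\langle f, \pi(\lambda) g\rangle|^2 \le B \lVert f \rVert_2^2,$$ where $\langle f,g\rangle = \int_{\mathbb{R}} f(t)\overline{g(t)}\,dt$. The $n$-th order Hermite function ($n \ge 0$ an integer) is $$h_n(t) = (-1)^n C_n e^{\pi t^2} \frac{d^n}{dt^n} e^{-2\pi t^2}, \quad t \in \mathbb{R}, \qquad C_n = \frac{2^{1/4}}{\sqrt{(2\pi)^n 2^n n!}}.$$ Here $(\mathbb{Z}+\tfrac12)^2 = \{(k+\tfrac12, l+\tfrac12) \mid k,l \in \mathbb{Z}\}$.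 *)

theory Defs
  imports "HOL-Analysis.Analysis"
begin

text \<open>Elements of \<open>L\<^sup>2(\<real>)\<close> are represented by square-integrable Borel functions. No quotient by
  almost-everywhere equality is taken: all notions below are invariant under it.\<close>

definition L2 :: "(real \<Rightarrow> complex) set" where
  "L2 = {f \<in> borel_measurable lborel. integrable lborel (\<lambda>t. (cmod (f t))\<^sup>2)}"

definition L2_inner :: "(real \<Rightarrow> complex) \<Rightarrow> (real \<Rightarrow> complex) \<Rightarrow> complex" where
  "L2_inner f g = (LINT t|lborel. f t * cnj (g t))"

definition L2_norm :: "(real \<Rightarrow> complex) \<Rightarrow> real" where
  "L2_norm f = sqrt (LINT t|lborel. (cmod (f t))\<^sup>2)"

definition translation :: "real \<Rightarrow> (real \<Rightarrow> complex) \<Rightarrow> real \<Rightarrow> complex" where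
  "translation x f = (\<lambda>t. f (t - x))"

definition modulation :: "real \<Rightarrow> (real \<Rightarrow> complex) \<Rightarrow> real \<Rightarrow> complex" where
  "modulation \<omega> f = (\<lambda>t. exp (2 * of_real pi * \<i> * of_real \<omega> * of_real t) * f t)"

definition tf_shift :: "real \<times> real \<Rightarrow> (real \<Rightarrow> complex) \<Rightarrow> real \<Rightarrow> complex" where
  "tf_shift z f = modulation (snd z) (translation (fst z) f)"

text \<open>The frame sum ranges over the index set \<open>\<Lambda>\<close>. Its convergence is stated explicitly, since
  \<^const>\<open>infsum\<close> is \<open>0\<close> on families that are not summable.\<close>

definition is_gabor_frame :: "(real \<Rightarrow> complex) \<Rightarrow> (real \<times> real) set \<Rightarrow> bool" where
  "is_gabor_frame g \<Lambda> \<longleftrightarrow>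
    (\<exists>A B :: real. 0 < A \<and> A \<le> B \<and>
      (\<forall>f\<in>L2.
        (\<lambda>l. (cmod (L2_inner f (tf_shift l g)))\<^sup>2) summable_on \<Lambda> \<and>
        A * (L2_norm f)\<^sup>2 \<le> (\<Sum>\<^sub>\<infinity>l\<in>\<Lambda>. (cmod (L2_inner f (tf_shift l g)))\<^sup>2) \<and>
        (\<Sum>\<^sub>\<infinity>l\<in>\<Lambda>. (cmod (L2_inner f (tf_shift l g)))\<^sup>2) \<le> B * (L2_norm f)\<^sup>2))"

definition hermite_const :: "nat \<Rightarrow> real" where
  "hermite_const n = 2 powr (1/4) / sqrt ((2 * pi) ^ n * 2 ^ n * fact n)"

definition hermite_fun :: "nat \<Rightarrow> real \<Rightarrow> complex" where
  "hermite_fun n t = of_real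
    ((-1) ^ n * hermite_const n * exp (pi * t\<^sup>2) * (deriv ^^ n) (\<lambda>s. exp (- 2 * pi * s\<^sup>2)) t)"

definition int_lattice :: "(real \<times> real) set" where
  "int_lattice = {(of_int k, of_int l) | k l :: int. True}"

definition half_int_lattice :: "(real \<times> real) set" where
  "half_int_lattice = {(of_int k + 1/2, of_int l + 1/2) | k l :: int. True}"

end

theory Submission
  imports Defs "HOL-Complex_Analysis.Complex_Analysis" "HOL-Probability.Probability"
begin

text \<open>Write \<open>g\<close> for the Hermite function. On each of the two cosets of \<open>\<int>\<^sup>2\<close> the sum over the frequencies
  is controlled by Bessel's inequality on \<open>[0, 1]\<close>, which reduces the frame sum to the Zak transform
  of \<open>g\<close> near \<open>(0, 0)\<close> and near \<open>(1/2, 1/2)\<close>. The system is not a frame because \<open>g\<close> has a zero of its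
  Zak transform at both points: testing with the indicator function of \<open>N\<close> consecutive
  intervals \<open>[n, n + \<epsilon>)\<close> makes the frame sum \<open>\<epsilon> (o(N) + O(1))\<close>, while the squared norm is \<open>\<epsilon> N\<close>.

  The zero at \<open>(1/2, 1/2)\<close> comes from \<open>g\<close> being even. The zero at \<open>(0, 0)\<close> means that \<open>g\<close> sums
  to \<open>0\<close> over the integers. Up to normalisation, that sum is the derivative of order \<open>4m + 2\<close> at
  \<open>s = 0\<close> of \<open>\<theta>(s) = \<Sum>\<^sub>k exp (- \<pi> k\<^sup>2 + 4 \<pi> k s - 2 \<pi> s\<^sup>2)\<close>. Poisson summation for the Gaussian
  gives \<open>\<theta>(s) = \<theta>(- \<i> s)\<close>, so only derivatives whose order is divisible by \<open>4\<close> survive.\<close>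

section \<open>Sums over windows of integers\<close>


lemma summable_exp_int: "(\<lambda>j::int. exp (- \<bar>of_int j :: real\<bar>)) summable_on UNIV"
proof -
  have geo: "(\<lambda>n::nat. exp (- real n)) summable_on UNIV"
  proof -
    have "summable (\<lambda>n::nat. exp (-1 :: real) ^ n)"
      by (rule summable_geometric) simp
    then have "summable (\<lambda>n::nat. exp (- real n))"
      by (simp add: exp_of_nat_mult [symmetric])
    then show ?thesis
      by (intro norm_summable_imp_summable_on) simp
  qed
  have 1: "(\<lambda>j::int. exp (- \<bar>of_int j :: real\<bar>)) summable_on range int"
    by (subst summable_on_reindex) (auto simp: o_def geo)
  have 2: "(\<lambda>j::int. exp (- \<bar>of_int j :: real\<bar>)) summable_on range (\<lambda>n. - int n)"
    by (subst summable_on_reindex) (auto simp: o_def geo inj_on_def)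
  have "range int \<union> range (\<lambda>n. - int n) = UNIV"
  proof -
    have "x \<in> range int \<union> range (\<lambda>n. - int n)" for x
      by (cases x rule: int_cases2) auto
    then show ?thesis by blast
  qed
  then show ?thesis
    using summable_on_Un_disjoint[OF 1 summable_on_subset_banach[OF 2, of "range (\<lambda>n. - int n) - range int"]]
    by (simp add: Un_Diff_cancel)
qed

lemma has_sum_finite_sum:
  fixes f :: "'i \<Rightarrow> 'a \<Rightarrow> 'b::{topological_comm_monoid_add, t2_space}"
  assumes "\<And>i. i \<in> K \<Longrightarrow> (f i has_sum S i) A"
  shows "((\<lambda>x. \<Sum>i\<in>K. f i x) has_sum (\<Sum>i\<in>K. S i)) A"
  using assms by (induction K rule: infinite_finite_induct) (auto intro: has_sum_add)

text \<open>Shifting a window by \<open>j\<close> changes its indicator only near its two ends, on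
  at most \<open>\<bar>j\<bar>\<close> integers each. What matters is that this edge effect does not
  grow with \<open>N\<close>.\<close>

lemma sum_abs_shift_indicator_le:
  fixes K :: "int set" and j N :: int
  assumes "finite K" "N \<ge> 0"
  defines "c \<equiv> \<lambda>i. if 0 \<le> i \<and> i < N then 1 else 0 :: real"
  shows "(\<Sum>k\<in>K. \<bar>c (k + j) - c k\<bar>) \<le> 2 * \<bar>of_int j\<bar>"
proof -
  define D where "D = {min 0 (-j)..<max 0 (-j)} \<union> {N + min 0 (-j)..<N + max 0 (-j)}"
  have "(\<Sum>k\<in>K. \<bar>c (k + j) - c k\<bar>) \<le> (\<Sum>k\<in>K. if k \<in> D then 1 else 0)"
    by (rule sum_mono) (auto simp: c_def D_def)
  also have "\<dots> = real (card (K \<inter> D))"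
    using assms by (simp add: sum.If_cases)
  also have "\<dots> \<le> real (card D)"
    by (intro of_nat_mono card_mono) (auto simp: D_def)
  also have "\<dots> \<le> real (nat \<bar>j\<bar> + nat \<bar>j\<bar>)"
    unfolding D_def
    by (intro of_nat_mono order_trans[OF card_Un_le] add_mono) auto
  finally show ?thesis by simp
qed

text \<open>The inner sum is close to the full sum of \<open>u\<close> for \<open>k\<close> inside
  the window and close to 0 outside. The total error is an edge effect, bounded by the first moment
  of \<open>u\<close> independently of \<open>N\<close>, so that growth in \<open>N\<close> can only
  come from the full sum.\<close>

lemma window_sum_bound:
  fixes u :: "int \<Rightarrow> complex"
  assumes sm: "(\<lambda>j. (1 + \<bar>of_int j\<bar>) * cmod (u j)) summable_on UNIV"
    and M: "(\<Sum>\<^sub>\<infinity>j. (1 + \<bar>of_int j\<bar>) * cmod (u j)) \<le> M"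
    and K: "finite K"
  shows "(\<Sum>k\<in>K. (cmod (\<Sum>n\<in>{0..<int N}. u (n - k)))\<^sup>2)
           \<le> M * (N * cmod (\<Sum>\<^sub>\<infinity>j. u j) + 2 * M)"
proof -
  define c :: "int \<Rightarrow> real" where "c = (\<lambda>i. if 0 \<le> i \<and> i < int N then 1 else 0)"
  define T where "T = (\<lambda>k. \<Sum>n\<in>{0..<int N}. u (n - k))"
  define Z where "Z = (\<Sum>\<^sub>\<infinity>j. u j)"
  have sn: "(\<lambda>j. cmod (u j)) summable_on UNIV"
    by (rule summable_on_comparison_test[OF sm]) (auto simp: algebra_simps)
  have sj: "(\<lambda>j. 2 * \<bar>of_int j\<bar> * cmod (u j)) summable_on UNIV"
    by (rule summable_on_comparison_test[OF summable_on_cmult_right[OF sm, of 2]]) (auto simp: algebra_simps)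
  have su: "u summable_on UNIV"
    using sn by (rule abs_summable_summable)
  have M0: "0 \<le> M"
    by (rule order_trans[OF infsum_nonneg M]) auto
  have T_le: "cmod (T k) \<le> M" for k
  proof -
    have "cmod (T k) \<le> (\<Sum>n\<in>{0..<int N}. cmod (u (n - k)))"
      unfolding T_def by (rule norm_sum)
    also have "\<dots> = (\<Sum>j\<in>(\<lambda>n. n - k) ` {0..<int N}. cmod (u j))"
      by (subst sum.reindex) (auto simp: inj_on_def)
    also have "\<dots> \<le> (\<Sum>\<^sub>\<infinity>j. cmod (u j))"
      by (rule finite_sum_le_infsum[OF sn]) auto
    also have "\<dots> \<le> (\<Sum>\<^sub>\<infinity>j. (1 + \<bar>of_int j\<bar>) * cmod (u j))"
      by (rule infsum_mono[OF sn sm]) (auto simp: algebra_simps)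
    finally show ?thesis using M by linarith
  qed
  have sd: "(\<lambda>j. \<bar>c (k + j) - c k\<bar> * cmod (u j)) summable_on UNIV" for k
    by (rule summable_on_comparison_test[OF sn]) (auto simp: c_def)
  \<comment> \<open>Writing \<open>c (k + j)\<close> as \<open>c k\<close> plus a difference
    separates the full sum \<open>Z\<close> from the edge effect.\<close>
  have T_eq: "T k = of_real (c k) * Z + (\<Sum>\<^sub>\<infinity>j. of_real (c (k + j) - c k) * u j)" for k
  proof -
    have s1: "(\<lambda>j. of_real (c (k + j) - c k) * u j) summable_on UNIV"
      by (rule abs_summable_summable) (use sd[of k] in \<open>simp add: norm_mult del: of_real_diff\<close>)
    have "T k = (\<Sum>j\<in>(\<lambda>n. n - k) ` {0..<int N}. u j)"
      unfolding T_def by (subst sum.reindex) (auto simp: inj_on_def)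
    also have "\<dots> = (\<Sum>\<^sub>\<infinity>j\<in>(\<lambda>n. n - k) ` {0..<int N}. u j)"
      by simp
    also have "\<dots> = (\<Sum>\<^sub>\<infinity>j. of_real (c (k + j)) * u j)"
    proof (rule infsum_cong_neutral)
      fix j assume "j \<in> UNIV - (\<lambda>n. n - k) ` {0..<int N}"
      then have "k + j \<notin> {0..<int N}"
        by (metis DiffD2 add_diff_cancel_left' imageI)
      then show "complex_of_real (c (k + j)) * u j = 0" by (auto simp: c_def)
    qed (auto simp: c_def)
    also have "\<dots> = (\<Sum>\<^sub>\<infinity>j. of_real (c k) * u j + of_real (c (k + j) - c k) * u j)"
      by (simp add: algebra_simps)
    also have "\<dots> = of_real (c k) * Z + (\<Sum>\<^sub>\<infinity>j. of_real (c (k + j) - c k) * u j)"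
      unfolding Z_def
      by (subst infsum_add[OF summable_on_cmult_right[OF su] s1]) (simp add: infsum_cmult_right su)
    finally show ?thesis .
  qed
  have T_norm: "cmod (T k) \<le> c k * cmod Z + (\<Sum>\<^sub>\<infinity>j. \<bar>c (k + j) - c k\<bar> * cmod (u j))" for k
  proof -
    have "cmod (\<Sum>\<^sub>\<infinity>j. of_real (c (k + j) - c k) * u j) \<le> (\<Sum>\<^sub>\<infinity>j. cmod (of_real (c (k + j) - c k) * u j))"
      using sd[of k] by (intro norm_infsum_bound) (simp add: norm_mult del: of_real_diff)
    also have "\<dots> = (\<Sum>\<^sub>\<infinity>j. \<bar>c (k + j) - c k\<bar> * cmod (u j))"
      by (simp add: norm_mult del: of_real_diff)
    finally have "cmod (\<Sum>\<^sub>\<infinity>j. of_real (c (k + j) - c k) * u j) \<le> (\<Sum>\<^sub>\<infinity>j. \<bar>c (k + j) - c k\<bar> * cmod (u j))" .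
    moreover have "cmod (of_real (c k) * Z) = c k * cmod Z"
      by (simp add: norm_mult c_def)
    ultimately show ?thesis
      unfolding T_eq[of k] by (intro norm_triangle_le) linarith
  qed
  have c_sum: "(\<Sum>k\<in>K. c k) \<le> N"
  proof -
    have "(\<Sum>k\<in>K. c k) = real (card (K \<inter> {0..<int N}))"
      unfolding c_def using K by (subst sum.If_cases) (auto intro!: arg_cong[where f = card])
    also have "\<dots> \<le> real (card {0..<int N})"
      by (intro of_nat_mono card_mono) auto
    finally show ?thesis by simp
  qed
  \<comment> \<open>Exchanging the sums allows the edge count to be applied for each fixed
    \<open>j\<close>.\<close>
  have sds: "((\<lambda>j. \<Sum>k\<in>K. \<bar>c (k + j) - c k\<bar> * cmod (u j)) has_sum
      (\<Sum>k\<in>K. \<Sum>\<^sub>\<infinity>j. \<bar>c (k + j) - c k\<bar> * cmod (u j))) UNIV"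
    using sd by (intro has_sum_finite_sum has_sum_infsum)
  then have "(\<Sum>k\<in>K. \<Sum>\<^sub>\<infinity>j. \<bar>c (k + j) - c k\<bar> * cmod (u j))
        = (\<Sum>\<^sub>\<infinity>j. \<Sum>k\<in>K. \<bar>c (k + j) - c k\<bar> * cmod (u j))"
    by (simp add: infsumI)
  also have "\<dots> \<le> (\<Sum>\<^sub>\<infinity>j. 2 * \<bar>of_int j\<bar> * cmod (u j))"
  proof (rule infsum_mono[OF _ sj])
    show "(\<lambda>j. \<Sum>k\<in>K. \<bar>c (k + j) - c k\<bar> * cmod (u j)) summable_on UNIV"
      using sds by (rule has_sum_imp_summable)
    show "(\<Sum>k\<in>K. \<bar>c (k + j) - c k\<bar> * cmod (u j)) \<le> 2 * \<bar>of_int j\<bar> * cmod (u j)" for j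
      unfolding sum_distrib_right[symmetric] c_def
      by (rule mult_right_mono[OF sum_abs_shift_indicator_le[OF K]]) auto
  qed
  also have "\<dots> \<le> (\<Sum>\<^sub>\<infinity>j. 2 * ((1 + \<bar>of_int j\<bar>) * cmod (u j)))"
    by (rule infsum_mono[OF sj summable_on_cmult_right[OF sm]]) (auto simp: algebra_simps)
  also have "\<dots> \<le> 2 * M"
    using M by (subst infsum_cmult_right) (auto intro: sm)
  finally have D: "(\<Sum>k\<in>K. \<Sum>\<^sub>\<infinity>j. \<bar>c (k + j) - c k\<bar> * cmod (u j)) \<le> 2 * M" .
  have "(\<Sum>k\<in>K. cmod (T k)) \<le> (\<Sum>k\<in>K. c k * cmod Z + (\<Sum>\<^sub>\<infinity>j. \<bar>c (k + j) - c k\<bar> * cmod (u j)))"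
    by (rule sum_mono[OF T_norm])
  also have "\<dots> \<le> N * cmod Z + 2 * M"
    unfolding sum.distrib sum_distrib_right[symmetric]
    by (intro add_mono mult_right_mono c_sum D) auto
  finally have S: "(\<Sum>k\<in>K. cmod (T k)) \<le> N * cmod Z + 2 * M" .
  \<comment> \<open>One factor of each square is bounded by \<open>M\<close>; what remains is the
    sum of absolute values just estimated.\<close>
  have "(\<Sum>k\<in>K. (cmod (T k))\<^sup>2) \<le> (\<Sum>k\<in>K. M * cmod (T k))"
    by (rule sum_mono) (auto simp: power2_eq_square intro: mult_right_mono T_le)
  also have "\<dots> \<le> M * (N * cmod Z + 2 * M)"
    unfolding sum_distrib_left[symmetric] by (rule mult_left_mono[OF S M0])
  finally show ?thesis unfolding T_def Z_def .
qed

section \<open>Bessel's inequality on the unit interval\<close>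


abbreviation unit_interval :: "real measure" where
  "unit_interval \<equiv> restrict_space lborel {0..1}"

definition fourier_char :: "int \<Rightarrow> real \<Rightarrow> complex" where
  "fourier_char n t = cis (2 * pi * of_int n * t)"

lemma fourier_char_measurable [measurable]: "fourier_char n \<in> borel_measurable borel"
  unfolding fourier_char_def[abs_def]
  by (intro borel_measurable_continuous_onI continuous_intros)

lemma measurable_cnj [measurable]: "cnj \<in> borel_measurable borel"
  by (intro borel_measurable_continuous_onI continuous_intros)

lemma norm_fourier_char [simp]: "cmod (fourier_char n t) = 1"
  by (simp add: fourier_char_def)

lemma fourier_char_add: "fourier_char (m + n) t = fourier_char m t * fourier_char n t"
  by (simp add: fourier_char_def cis_mult algebra_simps)

lemma cnj_fourier_char: "cnj (fourier_char n t) = fourier_char (- n) t"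
  by (simp add: fourier_char_def cis_cnj)

lemma fourier_char_add_int: "fourier_char n (t + of_int k) = fourier_char n t"
proof -
  have "cis (2 * pi * of_int n * (t + of_int k)) = cis (2 * pi * of_int n * t) * cis (2 * pi * of_int (n * k))"
    by (simp add: cis_mult algebra_simps)
  then show ?thesis
    by (simp add: fourier_char_def cis_multiple_2pi)
qed

lemma fourier_char_0 [simp]: "fourier_char 0 t = 1" "fourier_char n 0 = 1"
  by (simp_all add: fourier_char_def)

interpretation UI: finite_measure unit_interval
  by (rule finite_measureI) (simp add: space_restrict_space emeasure_restrict_space)

lemma integrable_unit_intervalI:
  fixes f :: "real \<Rightarrow> 'a::{banach, second_countable_topology}"
  assumes "f \<in> borel_measurable borel" "\<And>t. 0 \<le> t \<Longrightarrow> t \<le> 1 \<Longrightarrow> norm (f t) \<le> B"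
  shows "integrable unit_interval f"
  using assms
  by (intro UI.integrable_const_bound[where B = B] AE_I2)
     (auto simp: space_restrict_space measurable_restrict_space1)

lemma integral_unit_interval:
  fixes f :: "real \<Rightarrow> 'a::{banach, second_countable_topology}"
  shows "integral\<^sup>L unit_interval f = (LINT t|lborel. indicator {0..1} t *\<^sub>R f t)"
  by (simp add: integral_restrict_space)

lemma integral_fourier_char:
  "integral\<^sup>L unit_interval (fourier_char n) = (if n = 0 then 1 else 0)"
proof (cases "n = 0")
  case True
  then have "fourier_char n = (\<lambda>t. 1)"
    by auto
  then have "integral\<^sup>L unit_interval (fourier_char n) = 1"
    by (simp only: integral_unit_interval) simp
  then show ?thesis using True by simp
next
  case False
  define F where "F = (\<lambda>t. fourier_char n t / (2 * pi * \<i> * of_int n))"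
  have fc: "fourier_char n t = exp (2 * pi * \<i> * of_int n * of_real t)" for t
    by (simp add: fourier_char_def cis_conv_exp mult_ac)
  have "((\<lambda>z. exp (2 * pi * \<i> * of_int n * z) / (2 * pi * \<i> * of_int n)) has_field_derivative
      exp (2 * pi * \<i> * of_int n * z)) (at z)" for z
    using False by (auto intro!: derivative_eq_intros)
  then have "(F has_vector_derivative fourier_char n t) (at t within {0..1})" for t
    unfolding F_def fc by (rule has_vector_derivative_real_field)
  then have "(LINT t|lborel. indicator {0..1} t *\<^sub>R fourier_char n t) = F 1 - F 0"
    by (intro integral_FTC_atLeastAtMost)
       (auto simp: fourier_char_def[abs_def] intro!: continuous_intros)
  moreover have "F 1 = F 0"
    using fourier_char_add_int[of n 0 1] by (simp add: F_def)
  ultimately show ?thesis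
    using False by (simp add: integral_unit_interval)
qed

text \<open>With \<open>p\<close> the Fourier partial sum over \<open>L\<close>, the nonnegative
  integral of \<open>(cmod (\<phi> t - p t))\<^sup>2\<close> is expanded; orthonormality evaluates
  the two terms involving \<open>p\<close>. Boundedness of \<open>\<phi>\<close> makes every
  integral in the expansion exist.\<close>

lemma bessel_inequality:
  fixes \<phi> :: "real \<Rightarrow> complex"
  assumes [measurable]: "\<phi> \<in> borel_measurable borel"
    and bound: "\<And>t. 0 \<le> t \<Longrightarrow> t \<le> 1 \<Longrightarrow> cmod (\<phi> t) \<le> B"
    and L: "finite L"
  shows "(\<Sum>l\<in>L. (cmod (LINT t|unit_interval. \<phi> t * fourier_char (- l) t))\<^sup>2)
           \<le> (LINT t|unit_interval. (cmod (\<phi> t))\<^sup>2)"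
proof -
  define c where "c = (\<lambda>l. LINT t|unit_interval. \<phi> t * fourier_char (- l) t)"
  define p where "p = (\<lambda>t. \<Sum>l\<in>L. c l * fourier_char l t)"
  define P where "P = (\<Sum>l\<in>L. cmod (c l))"
  have [measurable]: "p \<in> borel_measurable borel"
    unfolding p_def by measurable
  have p_bd: "cmod (p t) \<le> P" for t
    unfolding p_def P_def by (rule order_trans[OF norm_sum]) (simp add: norm_mult)
  have B0: "0 \<le> B"
    using order_trans[OF norm_ge_zero bound[of 0]] by simp
  have i1: "integrable unit_interval (\<lambda>t. \<phi> t * fourier_char l t)" for l
    by (rule integrable_unit_intervalI[where B = B]) (auto simp: norm_mult bound)
  have i2: "integrable unit_interval (\<lambda>t. (cmod (\<phi> t))\<^sup>2)"
    by (rule integrable_unit_intervalI[where B = "B\<^sup>2"]) (auto simp: bound power_mono)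
  have i3: "integrable unit_interval (\<lambda>t. \<phi> t * cnj (p t))"
    by (rule integrable_unit_intervalI[where B = "B * P"]) (auto simp: norm_mult bound p_bd B0 intro!: mult_mono)
  have i4: "integrable unit_interval (\<lambda>t. p t * cnj (p t))"
    by (rule integrable_unit_intervalI[where B = "P * P"]) (auto simp: norm_mult p_bd order_trans[OF norm_ge_zero p_bd] intro!: mult_mono)
  have ic: "integrable unit_interval (fourier_char n)" for n
    by (rule integrable_unit_intervalI[where B = 1]) auto
  have "(LINT t|unit_interval. \<phi> t * cnj (p t)) = (LINT t|unit_interval. (\<Sum>l\<in>L. cnj (c l) * (\<phi> t * fourier_char (- l) t)))"
    by (simp add: p_def sum_distrib_left cnj_fourier_char mult_ac)
  also have "\<dots> = (\<Sum>l\<in>L. cnj (c l) * c l)"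
    by (subst Bochner_Integration.integral_sum) (auto simp: i1 c_def)
  finally have e1: "(LINT t|unit_interval. \<phi> t * cnj (p t)) = of_real (\<Sum>l\<in>L. (cmod (c l))\<^sup>2)"
    by (simp add: complex_norm_square mult.commute del: of_real_power)
  have "(LINT t|unit_interval. p t * cnj (p t))
      = (LINT t|unit_interval. (\<Sum>l\<in>L. \<Sum>k\<in>L. c l * cnj (c k) * fourier_char (l - k) t))"
  proof (rule arg_cong[where f = "integral\<^sup>L unit_interval"], rule ext)
    fix t
    have "fourier_char (l - k) t = fourier_char l t * cnj (fourier_char k t)" for k l
      using fourier_char_add[of l "-k" t] by (simp add: cnj_fourier_char)
    then show "p t * cnj (p t) = (\<Sum>l\<in>L. \<Sum>k\<in>L. c l * cnj (c k) * fourier_char (l - k) t)"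
      unfolding p_def cnj_sum sum_product by (simp add: mult_ac)
  qed
  also have "\<dots> = (\<Sum>l\<in>L. \<Sum>k\<in>L. c l * cnj (c k) * (if l - k = 0 then 1 else 0))"
    by (simp add: Bochner_Integration.integral_sum ic integral_fourier_char)
  also have "\<dots> = (\<Sum>l\<in>L. c l * cnj (c l))"
    using L by (intro sum.cong refl) (simp add: sum.delta' if_distrib cong: if_cong)
  finally have e2: "(LINT t|unit_interval. p t * cnj (p t)) = of_real (\<Sum>l\<in>L. (cmod (c l))\<^sup>2)"
    by (simp add: complex_norm_square del: of_real_power)
  have "0 \<le> (LINT t|unit_interval. (cmod (\<phi> t))\<^sup>2 - 2 * Re (\<phi> t * cnj (p t)) + Re (p t * cnj (p t)))"
  proof (rule Bochner_Integration.integral_nonneg)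
    fix t
    have "(cmod (\<phi> t - p t))\<^sup>2 = (cmod (\<phi> t))\<^sup>2 - 2 * Re (\<phi> t * cnj (p t)) + Re (p t * cnj (p t))"
      by (simp add: cmod_power2) (simp add: power2_eq_square algebra_simps)
    then show "0 \<le> (cmod (\<phi> t))\<^sup>2 - 2 * Re (\<phi> t * cnj (p t)) + Re (p t * cnj (p t))"
      by (metis zero_le_power2)
  qed
  also have "\<dots> = (LINT t|unit_interval. (cmod (\<phi> t))\<^sup>2) - 2 * Re (LINT t|unit_interval. \<phi> t * cnj (p t))
      + Re (LINT t|unit_interval. p t * cnj (p t))"
    using i2 i3 i4 by (simp del: complex_cnj_mult times_complex.simps)
  also have "\<dots> = (LINT t|unit_interval. (cmod (\<phi> t))\<^sup>2) - (\<Sum>l\<in>L. (cmod (c l))\<^sup>2)"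
    unfolding e1 e2 by simp
  finally show ?thesis unfolding c_def by simp
qed

section \<open>Frame sums of combs\<close>


text \<open>For \<epsilon> \<le> 1 this is the indicator of a union of intervals; the form of a sum
  permits termwise integration. With \<epsilon> = 1 it serves again in Poisson summation, as the
  cutoff to \<open>[-N, N)\<close>.\<close>

definition comb :: "int set \<Rightarrow> real \<Rightarrow> real \<Rightarrow> real" where
  "comb J \<epsilon> t = (\<Sum>n\<in>J. indicator {of_int n..<of_int n + \<epsilon>} t)"

lemma comb_measurable [measurable]: "comb J \<epsilon> \<in> borel_measurable borel"
  unfolding comb_def[abs_def] by measurable

lemma comb_nonneg: "0 \<le> comb J \<epsilon> t"
  unfolding comb_def by (rule sum_nonneg) simp

lemma comb_le: "comb J \<epsilon> t \<le> card J"
proof -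
  have "comb J \<epsilon> t \<le> (\<Sum>n\<in>J. 1)"
    unfolding comb_def by (rule sum_mono) (simp add: indicator_def)
  then show ?thesis by simp
qed

text \<open>The values are natural numbers. This bounds the squared norm from below by the integral
  of the comb itself.\<close>

lemma comb_le_square: "comb J \<epsilon> t \<le> (comb J \<epsilon> t)\<^sup>2"
proof -
  have "comb J \<epsilon> t = real (\<Sum>n\<in>J. if t \<in> {of_int n..<of_int n + \<epsilon>} then 1 else 0)"
    unfolding comb_def of_nat_sum by (rule sum.cong) auto
  then obtain m :: nat where "comb J \<epsilon> t = real m" by metis
  then show ?thesis
    by (metis of_nat_le_iff of_nat_power le_square power2_eq_square)
qed

lemma comb_has_integral:
  assumes "0 \<le> \<epsilon>"
  shows "has_bochner_integral lborel (comb J \<epsilon>) (real (card J) * \<epsilon>)"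
proof -
  have "has_bochner_integral lborel (comb J \<epsilon>) (\<Sum>n\<in>J. \<epsilon>)"
    unfolding comb_def[abs_def]
  proof (intro has_bochner_integral_sum)
    fix n
    show "has_bochner_integral lborel (indicator {of_int n..<of_int n + \<epsilon>}) \<epsilon>"
      using has_bochner_integral_real_indicator[of "{of_int n..<of_int n + \<epsilon>}" lborel] assms
      by (simp add: emeasure_lborel_Ico)
  qed
  then show ?thesis by simp
qed

lemma comb_square_integrable:
  assumes "0 \<le> \<epsilon>"
  shows "integrable lborel (\<lambda>t. (comb J \<epsilon> t)\<^sup>2)"
proof (rule Bochner_Integration.integrable_bound)
  show "integrable lborel (\<lambda>t. real (card J) * comb J \<epsilon> t)"
    using comb_has_integral[OF assms] by (auto simp: has_bochner_integral_iff)
  show "AE t in lborel. norm ((comb J \<epsilon> t)\<^sup>2) \<le> norm (real (card J) * comb J \<epsilon> t)"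
    using comb_nonneg comb_le by (auto simp: power2_eq_square abs_mult intro!: mult_right_mono)
qed measurable

lemma comb_in_L2: "0 \<le> \<epsilon> \<Longrightarrow> (\<lambda>t. complex_of_real (comb J \<epsilon> t)) \<in> L2"
  using comb_square_integrable[of \<epsilon> J] by (simp add: L2_def)

lemma L2_norm_comb_ge:
  assumes "0 \<le> \<epsilon>"
  shows "real (card J) * \<epsilon> \<le> (L2_norm (\<lambda>t. complex_of_real (comb J \<epsilon> t)))\<^sup>2"
proof -
  have "real (card J) * \<epsilon> = (LINT t|lborel. comb J \<epsilon> t)"
    using comb_has_integral[OF assms] by (simp add: has_bochner_integral_iff)
  also have "\<dots> \<le> (LINT t|lborel. (comb J \<epsilon> t)\<^sup>2)"
    using comb_has_integral[OF assms] comb_square_integrable[OF assms]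
    by (intro integral_mono) (auto simp: has_bochner_integral_iff comb_le_square)
  also have "\<dots> = (L2_norm (\<lambda>t. complex_of_real (comb J \<epsilon> t)))\<^sup>2"
    by (simp add: L2_norm_def)
  finally show ?thesis .
qed

text \<open>Translating each interval back to \<open>[0, \<epsilon>)\<close> folds the integral over
  the line onto the unit interval, which contains \<open>[0, \<epsilon>)\<close> because \<epsilon>
  \<le> 1.\<close>

lemma integral_comb_mult:
  fixes F :: "real \<Rightarrow> complex"
  assumes [measurable]: "F \<in> borel_measurable borel" and bd: "\<And>t. cmod (F t) \<le> B"
    and eps: "\<epsilon> \<le> 1"
  shows "(LINT t|lborel. of_real (comb J \<epsilon> t) * F t)
      = (LINT t|unit_interval. indicator {0..<\<epsilon>} t * (\<Sum>n\<in>J. F (t + of_int n)))"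
proof -
  have int: "integrable lborel (\<lambda>t. indicator {of_int n..<of_int n + \<epsilon>} t *\<^sub>R F (t + s))" for n s
  proof (rule integrableI_bounded_set_indicator[where B = B])
    show "emeasure lborel {of_int n..<of_int n + \<epsilon>} < \<infinity>"
      by (cases "\<epsilon> \<ge> 0") (auto simp: emeasure_lborel_Ico)
  qed (auto simp: bd)
  have int0: "integrable lborel (\<lambda>t. indicator {0..<\<epsilon>} t *\<^sub>R F (t + s))" for s
    using int[of 0 s] by simp
  have "(LINT t|lborel. of_real (comb J \<epsilon> t) * F t)
      = (LINT t|lborel. (\<Sum>n\<in>J. indicator {of_int n..<of_int n + \<epsilon>} t *\<^sub>R F t))"
    by (simp add: comb_def sum_distrib_right scaleR_conv_of_real)
  also have "\<dots> = (\<Sum>n\<in>J. (LINT t|lborel. indicator {of_int n..<of_int n + \<epsilon>} t *\<^sub>R F t))"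
    using int[of _ 0] by (intro Bochner_Integration.integral_sum) simp
  also have "\<dots> = (\<Sum>n\<in>J. (LINT t|lborel. indicator {0..<\<epsilon>} t *\<^sub>R F (t + of_int n)))"
  proof (rule sum.cong[OF refl])
    fix n
    have "indicator {real_of_int n..<of_int n + \<epsilon>} (of_int n + t) = (indicator {0..<\<epsilon>} t :: real)" for t
      by (auto simp: indicator_def)
    then show "(LINT t|lborel. indicator {of_int n..<of_int n + \<epsilon>} t *\<^sub>R F t)
        = (LINT t|lborel. indicator {0..<\<epsilon>} t *\<^sub>R F (t + of_int n))"
      by (subst lborel_integral_real_affine[where c = 1 and t = "of_int n"]) (simp_all add: add.commute)
  qed
  also have "\<dots> = (LINT t|lborel. (\<Sum>n\<in>J. indicator {0..<\<epsilon>} t *\<^sub>R F (t + of_int n)))"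
    using int0 by (intro Bochner_Integration.integral_sum [symmetric])
  also have "\<dots> = (LINT t|unit_interval. indicator {0..<\<epsilon>} t * (\<Sum>n\<in>J. F (t + of_int n)))"
    unfolding integral_unit_interval
    using eps by (intro arg_cong[where f = "integral\<^sup>L lborel"])
      (auto simp: fun_eq_iff sum_distrib_left indicator_def)
  finally show ?thesis .
qed

text \<open>Summed over \<open>j\<close>, this is the complex conjugate of the Zak transform of \<open>g\<close> at \<open>(t - \<alpha>, - \<alpha>)\<close>.\<close>

definition zak_term :: "(real \<Rightarrow> complex) \<Rightarrow> real \<Rightarrow> real \<Rightarrow> int \<Rightarrow> complex" where
  "zak_term g \<alpha> t j = cis (- 2 * pi * \<alpha> * of_int j) * cnj (g (t + of_int j - \<alpha>))"

text \<open>Folding turns the inner product into the Fourier coefficient of index \<open>l\<close>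
  of a function on the unit interval that does not depend on \<open>l\<close>, ready for Bessel's
  inequality. The phase is split at \<open>k\<close> so that the summands depend on
  \<open>n - k\<close> only and the remaining factor has modulus 1.\<close>

lemma L2_inner_comb_tf_shift:
  fixes k l :: int
  assumes [measurable]: "g \<in> borel_measurable borel" and bd: "\<And>t. cmod (g t) \<le> B" and eps: "\<epsilon> \<le> 1"
  shows "L2_inner (\<lambda>t. of_real (comb {0..<int N} \<epsilon> t)) (tf_shift (of_int k + \<alpha>, of_int l + \<alpha>) g)
    = (LINT t|unit_interval. (indicator {0..<\<epsilon>} t * cis (- 2 * pi * \<alpha> * (t + of_int k)) *
         (\<Sum>n\<in>{0..<int N}. zak_term g \<alpha> t (n - k))) * fourier_char (- l) t)"
proof -
  define F where "F = (\<lambda>t. cis (- 2 * pi * (of_int l + \<alpha>) * t) * cnj (g (t - (of_int k + \<alpha>))))"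
  have F: "cnj (tf_shift (of_int k + \<alpha>, of_int l + \<alpha>) g t) = F t" for t
    by (simp add: F_def tf_shift_def modulation_def translation_def cis_conv_exp exp_cnj mult_ac)
  have [measurable]: "F \<in> borel_measurable borel"
    unfolding F_def cis_conv_exp by measurable
  have F_shift: "F (t + of_int n) = cis (- 2 * pi * \<alpha> * (t + of_int k)) * zak_term g \<alpha> t (n - k) * fourier_char (- l) t" for t n
  proof -
    have "cis (- 2 * pi * (of_int l + \<alpha>) * (t + of_int n))
        = fourier_char (- l) (t + of_int n) * cis (- 2 * pi * \<alpha> * (t + of_int n))"
      by (simp add: fourier_char_def cis_mult algebra_simps)
    also have "cis (- 2 * pi * \<alpha> * (t + of_int n))
        = cis (- 2 * pi * \<alpha> * (t + of_int k)) * cis (- 2 * pi * \<alpha> * of_int (n - k))"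
      by (simp add: cis_mult algebra_simps)
    finally have e: "cis (- 2 * pi * (of_int l + \<alpha>) * (t + of_int n))
        = fourier_char (- l) t * (cis (- 2 * pi * \<alpha> * (t + of_int k)) * cis (- 2 * pi * \<alpha> * of_int (n - k)))"
      by (simp only: fourier_char_add_int)
    show ?thesis
      unfolding F_def e zak_term_def by (simp add: algebra_simps)
  qed
  have "L2_inner (\<lambda>t. of_real (comb {0..<int N} \<epsilon> t)) (tf_shift (of_int k + \<alpha>, of_int l + \<alpha>) g)
      = (LINT t|lborel. of_real (comb {0..<int N} \<epsilon> t) * F t)"
    by (simp add: L2_inner_def F)
  also have "\<dots> = (LINT t|unit_interval. indicator {0..<\<epsilon>} t * (\<Sum>n\<in>{0..<int N}. F (t + of_int n)))"
    by (rule integral_comb_mult[OF _ _ eps, where B = B]) (measurable, simp add: F_def norm_mult bd)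
  also have "\<dots> = (LINT t|unit_interval. (indicator {0..<\<epsilon>} t * cis (- 2 * pi * \<alpha> * (t + of_int k)) *
         (\<Sum>n\<in>{0..<int N}. zak_term g \<alpha> t (n - k))) * fourier_char (- l) t)"
    unfolding F_shift sum_distrib_left [symmetric] sum_distrib_right [symmetric] by (simp only: mult.assoc)
  finally show ?thesis .
qed

text \<open>Half of the decay rate 2 absorbs the weight \<open>1 + \<bar>of_int j\<bar>\<close> of
  \<open>window_sum_bound\<close>; the other half still leaves a summable majorant in
  \<open>j\<close>.\<close>

locale decaying_window =
  fixes g :: "real \<Rightarrow> complex" and C :: real
  assumes cont: "continuous_on UNIV g"
    and decay: "\<And>t. cmod (g t) \<le> C * exp (- 2 * \<bar>t\<bar>)"
begin

lemma C_nonneg: "0 \<le> C"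
  using order_trans[OF norm_ge_zero decay[of 0]] by simp

lemma g_bound: "cmod (g t) \<le> C"
proof -
  have "C * exp (- 2 * \<bar>t\<bar>) \<le> C * 1"
    by (rule mult_left_mono[OF _ C_nonneg]) simp
  then show ?thesis using decay[of t] by linarith
qed

lemma g_measurable [measurable]: "g \<in> borel_measurable borel"
  by (rule borel_measurable_continuous_onI[OF cont])

text \<open>The constant \<open>M\<close> for \<open>window_sum_bound\<close>, uniform over
  \<open>t\<close> and \<open>\<alpha>\<close> in \<open>[0, 1]\<close>. The factor
  \<open>exp 2\<close> pays for the displacement
  \<open>\<bar>t - \<alpha>\<bar> \<le> 1\<close>.\<close>

definition mass :: real where
  "mass = C * exp 2 * (\<Sum>\<^sub>\<infinity>j::int. exp (- \<bar>of_int j\<bar>))"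

lemma mass_nonneg: "0 \<le> mass"
  unfolding mass_def by (intro mult_nonneg_nonneg C_nonneg infsum_nonneg) auto

lemma zak_term_bound:
  assumes "0 \<le> t" "t \<le> 1" "0 \<le> \<alpha>" "\<alpha> \<le> 1"
  shows "(1 + \<bar>of_int j\<bar>) * cmod (zak_term g \<alpha> t j) \<le> C * exp 2 * exp (- \<bar>of_int j\<bar>)"
proof -
  have "cmod (zak_term g \<alpha> t j) \<le> C * exp (- 2 * \<bar>t + of_int j - \<alpha>\<bar>)"
    using decay[of "t + of_int j - \<alpha>"] by (simp add: zak_term_def norm_mult)
  also have "\<dots> \<le> C * exp (2 - 2 * \<bar>of_int j\<bar>)"
    using assms by (intro mult_left_mono C_nonneg) (auto simp: abs_if)
  finally have "(1 + \<bar>of_int j\<bar>) * cmod (zak_term g \<alpha> t j) \<le> exp \<bar>of_int j\<bar> * (C * exp (2 - 2 * \<bar>of_int j\<bar>))"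
    by (intro mult_mono exp_ge_add_one_self) auto
  also have "\<dots> = C * exp 2 * exp (- \<bar>of_int j\<bar>)"
    by (simp add: exp_diff exp_minus exp_double field_simps power2_eq_square mult_exp_exp)
  finally show ?thesis .
qed

lemma summable_majorant: "(\<lambda>j::int. C * exp 2 * exp (- \<bar>of_int j\<bar>)) summable_on UNIV"
  by (intro summable_on_cmult_right summable_exp_int)

lemma zak_term_mass:
  assumes "0 \<le> t" "t \<le> 1" "0 \<le> \<alpha>" "\<alpha> \<le> 1"
  shows "(\<lambda>j. (1 + \<bar>of_int j\<bar>) * cmod (zak_term g \<alpha> t j)) summable_on UNIV"
    and "(\<Sum>\<^sub>\<infinity>j. (1 + \<bar>of_int j\<bar>) * cmod (zak_term g \<alpha> t j)) \<le> mass"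
proof -
  show s: "(\<lambda>j. (1 + \<bar>of_int j\<bar>) * cmod (zak_term g \<alpha> t j)) summable_on UNIV"
    by (rule summable_on_comparison_test[OF summable_majorant]) (auto intro: zak_term_bound assms)
  show "(\<Sum>\<^sub>\<infinity>j. (1 + \<bar>of_int j\<bar>) * cmod (zak_term g \<alpha> t j)) \<le> mass"
    unfolding mass_def
    by (subst infsum_cmult_right[symmetric])
       (auto intro!: summable_exp_int infsum_mono s summable_majorant zak_term_bound assms)
qed

lemma continuous_zak:
  assumes "0 \<le> \<alpha>" "\<alpha> \<le> 1"
  shows "continuous_on {0..1} (\<lambda>t. \<Sum>\<^sub>\<infinity>j. zak_term g \<alpha> t j)"
proof (rule uniform_limit_theorem)
  show "uniform_limit {0..1} (\<lambda>J t. \<Sum>j\<in>J. zak_term g \<alpha> t j) (\<lambda>t. \<Sum>\<^sub>\<infinity>j. zak_term g \<alpha> t j)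
      (finite_subsets_at_top UNIV)"
  proof (rule Weierstrass_m_test_general[OF _ summable_majorant])
    fix j and t :: real assume "t \<in> {0..1}"
    then have "(1 + \<bar>of_int j\<bar>) * cmod (zak_term g \<alpha> t j) \<le> C * exp 2 * exp (- \<bar>of_int j\<bar>)"
      using assms by (intro zak_term_bound) auto
    moreover have "0 \<le> \<bar>of_int j\<bar> * cmod (zak_term g \<alpha> t j)"
      by simp
    ultimately show "norm (zak_term g \<alpha> t j) \<le> C * exp 2 * exp (- \<bar>of_int j\<bar>)"
      unfolding distrib_right by linarith
  qed
  show "\<forall>\<^sub>F J in finite_subsets_at_top UNIV. continuous_on {0..1} (\<lambda>t. \<Sum>j\<in>J. zak_term g \<alpha> t j)"
    unfolding zak_term_def
    by (intro always_eventually allI continuous_intros continuous_on_compose2[OF cont]) auto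
qed simp

text \<open>Bessel's inequality sums over \<open>l\<close> for each fixed \<open>k\<close> and
  leaves an integral over \<open>[0, \<epsilon>)\<close>; \<open>window_sum_bound\<close> then sums
  over \<open>k\<close> pointwise in \<open>t\<close>. The factor \<epsilon> is the length of that
  interval, and \<open>N\<close> enters only together with \<delta>.\<close>

lemma coset_sum_bound:
  assumes \<alpha>: "0 \<le> \<alpha>" "\<alpha> \<le> 1" and eps: "0 < \<epsilon>" "\<epsilon> \<le> 1"
    and \<delta>: "\<And>t. 0 \<le> t \<Longrightarrow> t < \<epsilon> \<Longrightarrow> cmod (\<Sum>\<^sub>\<infinity>j. zak_term g \<alpha> t j) \<le> \<delta>"
    and fin: "finite K" "finite L"
  shows "(\<Sum>k\<in>K. \<Sum>l\<in>L. (cmod (L2_inner (\<lambda>t. of_real (comb {0..<int N} \<epsilon> t))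
            (tf_shift (of_int k + \<alpha>, of_int l + \<alpha>) g)))\<^sup>2) \<le> \<epsilon> * (mass * (N * \<delta> + 2 * mass))"
proof -
  define S where "S = (\<lambda>k t. \<Sum>n\<in>{0..<int N}. zak_term g \<alpha> t (n - k))"
  define \<phi> where "\<phi> = (\<lambda>k t. indicator {0..<\<epsilon>} t * cis (- 2 * pi * \<alpha> * (t + of_int k)) * S k t)"
  have [measurable]: "S k \<in> borel_measurable borel" for k
    unfolding S_def zak_term_def by measurable
  have [measurable]: "\<phi> k \<in> borel_measurable borel" for k
    unfolding \<phi>_def cis_conv_exp by measurable
  have S_bd: "cmod (S k t) \<le> N * C" for k t
  proof -
    have "cmod (S k t) \<le> (\<Sum>n\<in>{0..<int N}. C)"
      unfolding S_def
      by (rule order_trans[OF norm_sum sum_mono]) (simp add: zak_term_def norm_mult g_bound)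
    then show ?thesis by simp
  qed
  have \<phi>_norm: "cmod (\<phi> k t) = indicator {0..<\<epsilon>} t * cmod (S k t)" for k t
    by (auto simp: \<phi>_def norm_mult indicator_def)
  have \<phi>_bd: "cmod (\<phi> k t) \<le> N * C" for k t
    unfolding \<phi>_norm using S_bd[of k t] C_nonneg by (auto simp: indicator_def)
  have \<phi>_int: "integrable unit_interval (\<lambda>t. (cmod (\<phi> k t))\<^sup>2)" for k
    by (rule integrable_unit_intervalI[where B = "(N * C)\<^sup>2"]) (auto simp: \<phi>_bd intro!: power_mono)
  have "(\<Sum>k\<in>K. \<Sum>l\<in>L. (cmod (L2_inner (\<lambda>t. of_real (comb {0..<int N} \<epsilon> t))
            (tf_shift (of_int k + \<alpha>, of_int l + \<alpha>) g)))\<^sup>2)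
      = (\<Sum>k\<in>K. \<Sum>l\<in>L. (cmod (LINT t|unit_interval. \<phi> k t * fourier_char (- l) t))\<^sup>2)"
    unfolding \<phi>_def S_def by (simp only: L2_inner_comb_tf_shift[OF g_measurable g_bound eps(2)])
  also have "\<dots> \<le> (\<Sum>k\<in>K. (LINT t|unit_interval. (cmod (\<phi> k t))\<^sup>2))"
    by (intro sum_mono bessel_inequality[OF _ \<phi>_bd fin(2)]) measurable
  also have "\<dots> = (LINT t|unit_interval. (\<Sum>k\<in>K. (cmod (\<phi> k t))\<^sup>2))"
    using \<phi>_int by (intro Bochner_Integration.integral_sum[symmetric])
  also have "\<dots> \<le> (LINT t|unit_interval. indicator {0..<\<epsilon>} t * (mass * (N * \<delta> + 2 * mass)))"
  proof (rule integral_mono)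
    show "integrable unit_interval (\<lambda>t. \<Sum>k\<in>K. (cmod (\<phi> k t))\<^sup>2)"
      by (intro Bochner_Integration.integrable_sum \<phi>_int)
    show "integrable unit_interval (\<lambda>t. indicator {0..<\<epsilon>} t * (mass * (N * \<delta> + 2 * mass)))"
      by (rule integrable_unit_intervalI[where B = "\<bar>mass * (N * \<delta> + 2 * mass)\<bar>"]) (auto simp: indicator_def)
    fix t
    show "(\<Sum>k\<in>K. (cmod (\<phi> k t))\<^sup>2) \<le> indicator {0..<\<epsilon>} t * (mass * (N * \<delta> + 2 * mass))"
    proof (cases "t \<in> {0..<\<epsilon>}")
      case True
      then have t: "0 \<le> t" "t \<le> 1" "t < \<epsilon>" using eps by auto
      have "(\<Sum>k\<in>K. (cmod (\<phi> k t))\<^sup>2) = (\<Sum>k\<in>K. (cmod (S k t))\<^sup>2)"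
        using True by (simp add: \<phi>_norm)
      also have "\<dots> \<le> mass * (N * cmod (\<Sum>\<^sub>\<infinity>j. zak_term g \<alpha> t j) + 2 * mass)"
        unfolding S_def
        by (rule window_sum_bound[OF zak_term_mass[OF t(1,2) \<alpha>] fin(1)])
      also have "\<dots> \<le> mass * (N * \<delta> + 2 * mass)"
        by (intro mult_left_mono add_right_mono mass_nonneg \<delta> t) auto
      finally show ?thesis using True by simp
    next
      case False
      then show ?thesis by (simp add: \<phi>_norm)
    qed
  qed
  also have "\<dots> = (LINT t|lborel. indicator {0..<\<epsilon>} t * (mass * (N * \<delta> + 2 * mass)))"
    unfolding integral_unit_interval
    using eps by (intro arg_cong[where f = "integral\<^sup>L lborel"]) (auto simp: indicator_def fun_eq_iff)
  also have "\<dots> = \<epsilon> * (mass * (N * \<delta> + 2 * mass))"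
    using eps by simp
  finally show ?thesis .
qed

end


section \<open>From one coset to the failure of the lower frame bound\<close>

context decaying_window
begin

lemma finite_coset_sum_bound:
  assumes \<alpha>: "0 \<le> \<alpha>" "\<alpha> \<le> 1" and eps: "0 < \<epsilon>" "\<epsilon> \<le> 1"
    and \<delta>: "\<And>t. 0 \<le> t \<Longrightarrow> t < \<epsilon> \<Longrightarrow> cmod (\<Sum>\<^sub>\<infinity>j. zak_term g \<alpha> t j) \<le> \<delta>"
    and F: "finite F" "F \<subseteq> {(of_int k + \<alpha>, of_int l + \<alpha>) | k l :: int. True}"
  shows "(\<Sum>z\<in>F. (cmod (L2_inner (\<lambda>t. of_real (comb {0..<int N} \<epsilon> t)) (tf_shift z g)))\<^sup>2)
      \<le> \<epsilon> * (mass * (N * \<delta> + 2 * mass))"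
proof -
  define f :: "int \<times> int \<Rightarrow> real \<times> real" where "f = (\<lambda>(k, l). (of_int k + \<alpha>, of_int l + \<alpha>))"
  define w where "w = (\<lambda>z. (cmod (L2_inner (\<lambda>t. of_real (comb {0..<int N} \<epsilon> t)) (tf_shift z g)))\<^sup>2)"
  have inj: "inj_on f S" for S
    by (auto simp: f_def inj_on_def)
  have "F \<subseteq> f ` UNIV"
    using F(2) by (force simp: f_def)
  then obtain P where P: "finite P" "F = f ` P"
    using F(1) by (meson finite_subset_image)
  have "sum w F = (\<Sum>p\<in>P. w (f p))"
    using P inj by (simp add: sum.reindex)
  \<comment> \<open>The index set is enlarged to a product, the shape that
    \<open>coset_sum_bound\<close> handles; the added terms are squares.\<close>
  also have "\<dots> \<le> (\<Sum>p\<in>fst ` P \<times> snd ` P. w (f p))"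
    by (rule sum_mono2) (use P subset_fst_snd[of P] in \<open>auto simp: w_def\<close>)
  also have "\<dots> = (\<Sum>k\<in>fst ` P. \<Sum>l\<in>snd ` P. w (f (k, l)))"
    by (simp add: sum.cartesian_product)
  also have "\<dots> \<le> \<epsilon> * (mass * (N * \<delta> + 2 * mass))"
    unfolding w_def f_def prod.case using P by (intro coset_sum_bound \<alpha> eps \<delta>) auto
  finally show ?thesis unfolding w_def .
qed

lemma zak_small_near_zero:
  assumes \<alpha>: "0 \<le> \<alpha>" "\<alpha> \<le> 1" and zero: "(\<Sum>\<^sub>\<infinity>j. zak_term g \<alpha> 0 j) = 0" and "0 < \<delta>"
  obtains \<epsilon> where "0 < \<epsilon>" "\<epsilon> \<le> 1"
    "\<And>t. 0 \<le> t \<Longrightarrow> t < \<epsilon> \<Longrightarrow> cmod (\<Sum>\<^sub>\<infinity>j. zak_term g \<alpha> t j) \<le> \<delta>"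
proof -
  obtain d where d: "0 < d" "\<And>t. t \<in> {0..1} \<Longrightarrow> dist t 0 < d \<Longrightarrow>
      dist (\<Sum>\<^sub>\<infinity>j. zak_term g \<alpha> t j) (\<Sum>\<^sub>\<infinity>j. zak_term g \<alpha> 0 j) < \<delta>"
    using continuous_zak[OF \<alpha>] \<open>0 < \<delta>\<close> unfolding continuous_on_iff
    by (metis atLeastAtMost_iff order_refl zero_le_one)
  show ?thesis
    by (rule that[of "min d 1"]) (use d zero in \<open>auto simp: dist_norm less_imp_le\<close>)
qed

lemma not_gabor_frame:
  assumes zero: "(\<Sum>\<^sub>\<infinity>j. zak_term g 0 0 j) = 0" "(\<Sum>\<^sub>\<infinity>j. zak_term g (1/2) 0 j) = 0"
  shows "\<not> is_gabor_frame g (int_lattice \<union> half_int_lattice)"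
proof
  assume "is_gabor_frame g (int_lattice \<union> half_int_lattice)"
  then obtain A where A: "0 < A" and frame: "\<And>f. f \<in> L2 \<Longrightarrow>
      (\<lambda>l. (cmod (L2_inner f (tf_shift l g)))\<^sup>2) summable_on (int_lattice \<union> half_int_lattice) \<and>
      A * (L2_norm f)\<^sup>2 \<le> (\<Sum>\<^sub>\<infinity>l\<in>int_lattice \<union> half_int_lattice. (cmod (L2_inner f (tf_shift l g)))\<^sup>2)"
    unfolding is_gabor_frame_def by blast
  \<comment> \<open>Up to the factor \<epsilon>, the terms of the two cosets that grow with
    \<open>N\<close> are \<open>2 * mass * N * \<delta> \<le> A * N / 2\<close>, half of the lower
    frame bound. Adding 1 keeps the denominator positive if \<open>mass\<close> is 0.\<close>
  define \<delta> where "\<delta> = A / (4 * (mass + 1))"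
  have \<delta>: "0 < \<delta>" using A mass_nonneg by (simp add: \<delta>_def)
  obtain \<epsilon>0 where e0: "0 < \<epsilon>0" "\<epsilon>0 \<le> 1"
    "\<And>t. 0 \<le> t \<Longrightarrow> t < \<epsilon>0 \<Longrightarrow> cmod (\<Sum>\<^sub>\<infinity>j. zak_term g 0 t j) \<le> \<delta>"
    using zak_small_near_zero[OF _ _ zero(1) \<delta>] by auto
  obtain \<epsilon>1 where e1: "0 < \<epsilon>1" "\<epsilon>1 \<le> 1"
    "\<And>t. 0 \<le> t \<Longrightarrow> t < \<epsilon>1 \<Longrightarrow> cmod (\<Sum>\<^sub>\<infinity>j. zak_term g (1/2) t j) \<le> \<delta>"
    using zak_small_near_zero[OF _ _ zero(2) \<delta>] by auto
  define \<epsilon> where "\<epsilon> = min \<epsilon>0 \<epsilon>1"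
  have eps: "0 < \<epsilon>" "\<epsilon> \<le> 1" using e0 e1 by (auto simp: \<epsilon>_def)
  \<comment> \<open>As \<epsilon> was fixed before \<open>N\<close>, it cancels and the estimate
    holds for all \<open>N\<close> at once, which is absurd for large \<open>N\<close>.\<close>
  have bound: "A * N \<le> 8 * mass\<^sup>2" for N :: nat
  proof -
    define f where "f = (\<lambda>t. complex_of_real (comb {0..<int N} \<epsilon> t))"
    define R where "R = \<epsilon> * (mass * (N * \<delta> + 2 * mass))"
    have fL2: "f \<in> L2"
      unfolding f_def using eps by (intro comb_in_L2) auto
    have "(\<Sum>\<^sub>\<infinity>l\<in>int_lattice \<union> half_int_lattice. (cmod (L2_inner f (tf_shift l g)))\<^sup>2) \<le> R + R"
    proof (rule infsum_le_finite_sums)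
      fix F assume F: "finite F" "F \<subseteq> int_lattice \<union> half_int_lattice"
      have "(\<Sum>l\<in>F. (cmod (L2_inner f (tf_shift l g)))\<^sup>2)
          \<le> (\<Sum>l\<in>F \<inter> int_lattice. (cmod (L2_inner f (tf_shift l g)))\<^sup>2)
            + (\<Sum>l\<in>F \<inter> half_int_lattice. (cmod (L2_inner f (tf_shift l g)))\<^sup>2)"
        using sum.union_inter[of "F \<inter> int_lattice" "F \<inter> half_int_lattice"
            "\<lambda>l. (cmod (L2_inner f (tf_shift l g)))\<^sup>2"] F
          sum_nonneg[of "F \<inter> int_lattice \<inter> (F \<inter> half_int_lattice)" "\<lambda>l. (cmod (L2_inner f (tf_shift l g)))\<^sup>2"]
        by (simp add: Int_Un_distrib[symmetric] Int_absorb2)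
      also have "\<dots> \<le> R + R"
        unfolding f_def R_def
      proof (rule add_mono)
        show "(\<Sum>l\<in>F \<inter> int_lattice. (cmod (L2_inner (\<lambda>t. of_real (comb {0..<int N} \<epsilon> t)) (tf_shift l g)))\<^sup>2)
            \<le> \<epsilon> * (mass * (N * \<delta> + 2 * mass))"
          by (rule finite_coset_sum_bound[where \<alpha> = 0])
             (use F e0 eps in \<open>auto simp: \<epsilon>_def int_lattice_def\<close>)
        show "(\<Sum>l\<in>F \<inter> half_int_lattice. (cmod (L2_inner (\<lambda>t. of_real (comb {0..<int N} \<epsilon> t)) (tf_shift l g)))\<^sup>2)
            \<le> \<epsilon> * (mass * (N * \<delta> + 2 * mass))"
          by (rule finite_coset_sum_bound[where \<alpha> = "1/2"])
             (use F e1 eps in \<open>auto simp: \<epsilon>_def half_int_lattice_def\<close>)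
      qed
      finally show "(\<Sum>l\<in>F. (cmod (L2_inner f (tf_shift l g)))\<^sup>2) \<le> R + R" .
    qed (use frame[OF fL2] in blast)
    moreover have "A * (N * \<epsilon>) \<le> A * (L2_norm f)\<^sup>2"
      unfolding f_def using L2_norm_comb_ge[of \<epsilon> "{0..<int N}"] eps A by (intro mult_left_mono) auto
    ultimately have "A * (N * \<epsilon>) \<le> R + R"
      using frame[OF fL2] by linarith
    then have "\<epsilon> * (A * N) \<le> \<epsilon> * (2 * (mass * (N * \<delta> + 2 * mass)))"
      by (simp add: R_def algebra_simps)
    then have "A * N \<le> 2 * (mass * (N * \<delta> + 2 * mass))"
      using eps by simp
    moreover have "mass * \<delta> \<le> A / 4"
      using A mass_nonneg by (simp add: \<delta>_def field_simps)
    then have "(mass * \<delta>) * N \<le> A / 4 * N"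
      by (intro mult_right_mono) auto
    ultimately show ?thesis
      by (simp add: algebra_simps power2_eq_square)
  qed
  obtain N :: nat where "8 * mass\<^sup>2 / A < N"
    using reals_Archimedean2 by blast
  with bound[of N] A show False
    by (simp add: field_simps)
qed

end

section \<open>Poisson summation\<close>


text \<open>Jordan's inequality: the sine is concave on \<open>[0, pi/2]\<close> and so lies above
  its chord.\<close>

lemma sin_pi_ge:
  assumes "0 \<le> t" "t \<le> 1/2"
  shows "2 * t \<le> sin (pi * t)"
proof -
  have conv: "convex_on {0..pi/2} (\<lambda>x. - sin x)"
  proof (rule f''_ge0_imp_convex[where f' = "\<lambda>x. - cos x" and f'' = sin])
    fix x assume "x \<in> {0..pi/2}"
    then show "0 \<le> sin x" by (intro sin_ge_zero) (auto simp: pi_ge_zero order_trans)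
  qed (auto intro!: derivative_eq_intros)
  have "- sin ((1 - 2 * t) *\<^sub>R 0 + (2 * t) *\<^sub>R (pi/2)) \<le> (1 - 2 * t) * (- sin 0) + (2 * t) * (- sin (pi/2))"
    using assms by (intro convex_onD[OF conv]) auto
  then show ?thesis by (simp add: mult.commute)
qed

text \<open>The modulus equals \<open>2 * sin (pi * t)\<close>. The bound shows that it vanishes
  only to first order at the end points, so a Lipschitz numerator vanishing there can be divided by
  it.\<close>

lemma norm_fourier_char_1_minus_1:
  assumes "0 \<le> t" "t \<le> 1"
  shows "4 * min t (1 - t) \<le> cmod (fourier_char 1 t - 1)"
proof -
  have "(cmod (fourier_char 1 t - 1))\<^sup>2 = (2 * sin (pi * t))\<^sup>2"
    using cos_double_sin[of "pi * t"] sin_cos_squared_add[of "2 * pi * t"]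
    by (simp add: fourier_char_def cmod_power2 power2_diff mult.assoc)
  moreover have "0 \<le> sin (pi * t)"
    using assms by (intro sin_ge_zero) auto
  ultimately have *: "cmod (fourier_char 1 t - 1) = 2 * sin (pi * t)"
    using power2_eq_iff_nonneg[of "cmod (fourier_char 1 t - 1)" "2 * sin (pi * t)"] by simp
  show ?thesis
  proof (cases "t \<le> 1/2")
    case True
    then show ?thesis using sin_pi_ge[of t] assms * by simp
  next
    case False
    have "sin (pi * (1 - t)) = sin (pi * t)"
      by (simp add: right_diff_distrib)
    then show ?thesis using sin_pi_ge[of "1 - t"] assms * False by simp
  qed
qed

text \<open>Links unordered sums to limits along a sequence. The half-open range fits the comb,
  whose unit intervals tile \<open>[-N, N)\<close>.\<close>

lemma filterlim_symmetric_int_interval: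
  "filterlim (\<lambda>N::nat. {- int N..<int N}) (finite_subsets_at_top UNIV) sequentially"
  unfolding filterlim_finite_subsets_at_top
proof (intro allI impI)
  fix X :: "int set" assume X: "finite X \<and> X \<subseteq> UNIV"
  show "\<forall>\<^sub>F N in sequentially. finite {- int N..<int N} \<and> X \<subseteq> {- int N..<int N} \<and> {- int N..<int N} \<subseteq> UNIV"
  proof (rule eventually_sequentiallyI[of "nat (\<Sum>x\<in>X. \<bar>x\<bar>) + 1"])
    fix N assume N: "nat (\<Sum>x\<in>X. \<bar>x\<bar>) + 1 \<le> N"
    have "\<bar>x\<bar> \<le> (\<Sum>x\<in>X. \<bar>x\<bar>)" if "x \<in> X" for x
      using X that by (intro member_le_sum) auto
    then show "finite {- int N..<int N} \<and> X \<subseteq> {- int N..<int N} \<and> {- int N..<int N} \<subseteq> UNIV"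
      using N by force
  qed
qed

lemma comb_symmetric: "comb {- int N..<int N} 1 t = indicator {- real N..<real N} t"
proof -
  have "comb {- int N..<int N} 1 t = (\<Sum>n\<in>{- int N..<int N}. if n = \<lfloor>t\<rfloor> then 1 else 0)"
    unfolding comb_def
  proof (rule sum.cong[OF refl])
    fix n show "indicator {of_int n..<of_int n + 1} t = (if n = \<lfloor>t\<rfloor> then 1 else 0 :: real)"
      by (auto simp: indicator_def floor_eq_iff) linarith+
  qed
  also have "\<dots> = indicator {- real N..<real N} t"
    by (auto simp: indicator_def le_floor_iff floor_less_iff)
  finally show ?thesis .
qed

text \<open>The decay of the derivative makes the periodization Lipschitz, which is the regularity
  used for pointwise convergence of its Fourier series at 0.\<close>

locale smooth_decaying = decaying_window g C for g :: "real \<Rightarrow> complex" and C +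
  fixes g' :: "real \<Rightarrow> complex" and C'
  assumes deriv: "\<And>t. (g has_vector_derivative g' t) (at t)"
    and deriv_decay: "\<And>t. cmod (g' t) \<le> C' * exp (- 2 * \<bar>t\<bar>)"
begin

definition periodization :: "real \<Rightarrow> complex" where
  "periodization t = (\<Sum>\<^sub>\<infinity>j::int. g (t + of_int j))"

lemma shift_decay:
  assumes "0 \<le> t" "t \<le> 1"
  shows "exp (- 2 * \<bar>t + of_int j\<bar>) \<le> exp 2 * exp (- \<bar>of_int j :: real\<bar>)"
  using assms by (auto simp: mult_exp_exp abs_if)

lemma summable_shifts:
  assumes "0 \<le> t" "t \<le> 1"
  shows "(\<lambda>j. cmod (g (t + of_int j))) summable_on UNIV" "(\<lambda>j::int. g (t + of_int j)) summable_on UNIV"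
proof -
  show "(\<lambda>j. cmod (g (t + of_int j))) summable_on UNIV"
  proof (rule summable_on_comparison_test[OF summable_majorant])
    fix j
    have "cmod (g (t + of_int j)) \<le> C * (exp 2 * exp (- \<bar>of_int j\<bar>))"
      by (rule order_trans[OF decay mult_left_mono[OF shift_decay[OF assms] C_nonneg]])
    then show "cmod (g (t + of_int j)) \<le> C * exp 2 * exp (- \<bar>of_int j\<bar>)"
      by simp
  qed simp
  then show "(\<lambda>j::int. g (t + of_int j)) summable_on UNIV"
    by (rule abs_summable_summable)
qed

lemma periodization_1: "periodization 1 = periodization 0"
proof -
  have "periodization 1 = (\<Sum>\<^sub>\<infinity>j\<in>range (\<lambda>j. 1 + j). g (0 + of_int j))"
    unfolding periodization_def by (subst infsum_reindex) (auto simp: inj_on_def o_def)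
  also have "range (\<lambda>j::int. 1 + j) = UNIV"
    by (metis add.commute diff_add_cancel surj_def)
  finally show ?thesis by (simp add: periodization_def)
qed

definition lip :: real where "lip = C' * exp 2 * (\<Sum>\<^sub>\<infinity>j::int. exp (- \<bar>of_int j\<bar>))"

text \<open>The mean value inequality on \<open>[j, j + 1]\<close> bounds each summand, and the
  decay of \<open>g'\<close> makes these bounds summable.\<close>

lemma periodization_lipschitz:
  assumes s: "0 \<le> s" "s \<le> 1" and t: "0 \<le> t" "t \<le> 1"
  shows "cmod (periodization t - periodization s) \<le> lip * \<bar>t - s\<bar>"
proof -
  have C'0: "0 \<le> C'"
    using order_trans[OF norm_ge_zero deriv_decay[of 0]] by simp
  have diff_le: "cmod (g (t + of_int j) - g (s + of_int j)) \<le> C' * exp 2 * \<bar>t - s\<bar> * exp (- \<bar>of_int j\<bar>)" for j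
  proof -
    have "cmod (g (t + of_int j) - g (s + of_int j))
        \<le> (C' * exp 2 * exp (- \<bar>of_int j\<bar>)) * norm ((t + of_int j) - (s + of_int j))"
    proof (rule differentiable_bound[where f' = "\<lambda>x h. h *\<^sub>R g' x" and S = "{of_int j..of_int j + 1}"])
      fix x assume x: "x \<in> {real_of_int j..of_int j + 1}"
      show "(g has_derivative (\<lambda>h. h *\<^sub>R g' x)) (at x within {real_of_int j..of_int j + 1})"
        using deriv[of x] unfolding has_vector_derivative_def by (rule has_derivative_at_withinI)
      have "cmod (g' x) \<le> C' * (exp 2 * exp (- \<bar>of_int j\<bar>))"
        using order_trans[OF deriv_decay mult_left_mono[OF shift_decay[of "x - of_int j" j] C'0]] x by simp
      from mult_right_mono[OF this] have "norm (h *\<^sub>R g' x) \<le> C' * exp 2 * exp (- \<bar>of_int j\<bar>) * norm h" for h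
        by (simp add: mult.assoc mult.commute[of "\<bar>h\<bar>"])
      then show "onorm (\<lambda>h. h *\<^sub>R g' x) \<le> C' * exp 2 * exp (- \<bar>of_int j\<bar>)"
        by (rule onorm_le)
    qed (use s t in auto)
    then show ?thesis by (simp add: mult_ac)
  qed
  have sm: "(\<lambda>j::int. C' * exp 2 * \<bar>t - s\<bar> * exp (- \<bar>of_int j\<bar>)) summable_on UNIV"
    by (intro summable_on_cmult_right summable_exp_int)
  have ab: "(\<lambda>j. cmod (g (t + of_int j) - g (s + of_int j))) summable_on UNIV"
    by (rule summable_on_comparison_test[OF sm]) (auto intro: diff_le)
  have "periodization t - periodization s = (\<Sum>\<^sub>\<infinity>j. g (t + of_int j) - g (s + of_int j))"
    unfolding periodization_def
    using infsum_add[OF summable_shifts(2)[OF t] summable_on_uminus[THEN iffD2, OF summable_shifts(2)[OF s]]]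
    by (simp add: infsum_uminus)
  also have "cmod \<dots> \<le> (\<Sum>\<^sub>\<infinity>j. cmod (g (t + of_int j) - g (s + of_int j)))"
    by (rule norm_infsum_bound[OF ab])
  also have "\<dots> \<le> (\<Sum>\<^sub>\<infinity>j::int. C' * exp 2 * \<bar>t - s\<bar> * exp (- \<bar>of_int j\<bar>))"
    by (rule infsum_mono[OF ab sm diff_le])
  also have "\<dots> = lip * \<bar>t - s\<bar>"
    unfolding lip_def by (subst infsum_cmult_right) (auto simp: summable_exp_int)
  finally show ?thesis .
qed

end


lemma sum_int_telescope:
  fixes q :: "int \<Rightarrow> 'a::ab_group_add"
  shows "(\<Sum>n\<in>{- int N..<int N}. q (n - 1) - q n) = q (- int N - 1) - q (int N - 1)"
proof (induction N)
  case (Suc N)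
  have "{- int (Suc N)..<int (Suc N)} = insert (- int N - 1) (insert (int N) {- int N..<int N})"
    by auto
  then show ?case
    using Suc by (simp add: algebra_simps)
qed simp

text \<open>The Riemann-Lebesgue lemma for bounded functions: by Bessel's inequality the squared
  coefficients are summable along any injective sequence of indices.\<close>

lemma fourier_coeff_tendsto_0:
  fixes f :: "nat \<Rightarrow> int"
  assumes Q: "Q \<in> borel_measurable borel" "\<And>t. 0 \<le> t \<Longrightarrow> t \<le> 1 \<Longrightarrow> cmod (Q t) \<le> B" and "inj f"
  shows "(\<lambda>N. LINT t|unit_interval. Q t * fourier_char (- f N) t) \<longlonglongrightarrow> 0"
proof -
  define q where "q = (\<lambda>n. LINT t|unit_interval. Q t * fourier_char (- n) t)"
  have "(\<Sum>i<N. (cmod (q (f i)))\<^sup>2) \<le> (LINT t|unit_interval. (cmod (Q t))\<^sup>2)" for N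
    using bessel_inequality[OF Q, where L = "f ` {..<N}"] \<open>inj f\<close>
    by (simp add: q_def sum.reindex inj_on_subset[OF \<open>inj f\<close>])
  then have "summable (\<lambda>N. (cmod (q (f N)))\<^sup>2)"
    by (intro summableI_nonneg_bounded) auto
  then have "(\<lambda>N. sqrt ((cmod (q (f N)))\<^sup>2)) \<longlonglongrightarrow> sqrt 0"
    by (intro tendsto_real_sqrt summable_LIMSEQ_zero)
  then show ?thesis
    unfolding q_def by (simp add: tendsto_norm_zero_iff)
qed

section \<open>Fourier coefficients of the periodization and the summation formula\<close>

context smooth_decaying
begin

lemma continuous_periodization: "continuous_on {0..1} periodization"
proof (rule lipschitz_on_continuous_on)
  have "0 \<le> C'"
    using order_trans[OF norm_ge_zero deriv_decay[of 0]] by simp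
  then have "0 \<le> lip"
    unfolding lip_def by (intro mult_nonneg_nonneg infsum_nonneg) auto
  then show "lip-lipschitz_on {0..1} periodization"
    by (intro lipschitz_onI) (auto simp: dist_norm periodization_lipschitz)
qed

text \<open>The integral over \<open>[-N, N)\<close> has two limits. On the line, dominated by
  \<open>cmod (g t)\<close>, it tends to the Fourier integral of \<open>g\<close>; folded onto the
  unit interval and dominated by the constant \<open>mass\<close>, it tends to the Fourier
  coefficient of the periodization.\<close>

lemma fourier_coeff_periodization:
  assumes int: "integrable lborel g"
  shows "(LINT t|unit_interval. periodization t * fourier_char (- n) t)
       = (LINT t|lborel. g t * fourier_char (- n) t)"
proof -
  define X where "X = (\<lambda>N. LINT t|lborel. of_real (comb {- int N..<int N} 1 t) * (g t * fourier_char (- n) t))"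
  \<comment> \<open>Continuity of the periodization is known on \<open>[0, 1]\<close>; extension by
    0 gives a function measurable on the whole line.\<close>
  define P where "P = (\<lambda>t. indicator {0..1} t *\<^sub>R periodization t)"
  have [measurable]: "P \<in> borel_measurable borel"
    unfolding P_def by (intro borel_measurable_continuous_on_indicator continuous_periodization) auto
  have lim1: "X \<longlonglongrightarrow> (LINT t|lborel. g t * fourier_char (- n) t)"
    unfolding X_def
  proof (rule integral_dominated_convergence[where w = "\<lambda>t. cmod (g t)"])
    show "integrable lborel (\<lambda>t. cmod (g t))"
      using int by simp
    show "AE t in lborel. (\<lambda>N. complex_of_real (comb {- int N..<int N} 1 t) * (g t * fourier_char (- n) t))
        \<longlonglongrightarrow> g t * fourier_char (- n) t"
    proof (rule AE_I2)
      fix t :: real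
      obtain M :: nat where M: "\<bar>t\<bar> < M"
        using reals_Archimedean2 by blast
      have "complex_of_real (comb {- int N..<int N} 1 t) * (g t * fourier_char (- n) t) = g t * fourier_char (- n) t"
        if "M \<le> N" for N
        using M that unfolding comb_symmetric by (auto simp: indicator_def)
      then show "(\<lambda>N. complex_of_real (comb {- int N..<int N} 1 t) * (g t * fourier_char (- n) t))
        \<longlonglongrightarrow> g t * fourier_char (- n) t"
        by (intro tendsto_eventually eventually_sequentiallyI[of M])
    qed
    show "AE t in lborel. cmod (complex_of_real (comb {- int N..<int N} 1 t) * (g t * fourier_char (- n) t)) \<le> cmod (g t)" for N
      unfolding comb_symmetric by (auto simp: norm_mult indicator_def)
  qed measurable
  have X_eq: "X N = (LINT t|unit_interval. indicator {0..<1} t *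
      ((\<Sum>j\<in>{- int N..<int N}. g (t + of_int j)) * fourier_char (- n) t))" for N
    unfolding X_def
    by (subst integral_comb_mult[where B = C])
       (auto simp: norm_mult g_bound fourier_char_add_int sum_distrib_right)
  have lim2: "X \<longlonglongrightarrow> (LINT t|unit_interval. indicator {0..<1} t *
      (P t * fourier_char (- n) t))"
    unfolding X_eq
  proof (rule integral_dominated_convergence[where w = "\<lambda>t. mass"])
    show "AE t in unit_interval. (\<lambda>N. indicator {0..<1} t *
        ((\<Sum>j\<in>{- int N..<int N}. g (t + of_int j)) * fourier_char (- n) t))
        \<longlonglongrightarrow> indicator {0..<1} t * (P t * fourier_char (- n) t)"
    proof (rule AE_I2)
      fix t assume "t \<in> space unit_interval"
      then have t: "0 \<le> t" "t \<le> 1"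
        by (auto simp: space_restrict_space)
      have "((\<lambda>j. g (t + of_int j)) has_sum periodization t) UNIV"
        unfolding periodization_def by (rule has_sum_infsum[OF summable_shifts(2)[OF t]])
      then have "(\<lambda>N. \<Sum>j\<in>{- int N..<int N}. g (t + of_int j)) \<longlonglongrightarrow> periodization t"
        unfolding has_sum_def by (rule filterlim_compose[OF _ filterlim_symmetric_int_interval])
      then show "(\<lambda>N. indicator {0..<1} t *
        ((\<Sum>j\<in>{- int N..<int N}. g (t + of_int j)) * fourier_char (- n) t))
        \<longlonglongrightarrow> indicator {0..<1} t * (P t * fourier_char (- n) t)"
        using t unfolding P_def by (auto intro!: tendsto_intros)
    qed
    fix N
    show "AE t in unit_interval. cmod (indicator {0..<1} t *
        ((\<Sum>j\<in>{- int N..<int N}. g (t + of_int j)) * fourier_char (- n) t)) \<le> mass"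
    proof (rule AE_I2)
      fix t assume "t \<in> space unit_interval"
      then have t: "0 \<le> t" "t \<le> 1"
        by (auto simp: space_restrict_space)
      have "cmod (indicator {0..<1} t * ((\<Sum>j\<in>{- int N..<int N}. g (t + of_int j)) * fourier_char (- n) t))
          \<le> cmod (\<Sum>j\<in>{- int N..<int N}. g (t + of_int j))"
        by (auto simp: norm_mult indicator_def)
      also have "\<dots> \<le> (\<Sum>j\<in>{- int N..<int N}. cmod (g (t + of_int j)))"
        by (rule norm_sum)
      also have "\<dots> \<le> (\<Sum>\<^sub>\<infinity>j. cmod (g (t + of_int j)))"
        by (rule finite_sum_le_infsum[OF summable_shifts(1)[OF t]]) auto
      also have "\<dots> \<le> (\<Sum>\<^sub>\<infinity>j::int. C * exp 2 * exp (- \<bar>of_int j\<bar>))"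
      proof (rule infsum_mono[OF summable_shifts(1)[OF t] summable_majorant])
        fix j
        show "cmod (g (t + of_int j)) \<le> C * exp 2 * exp (- \<bar>of_int j\<bar>)"
          using order_trans[OF decay mult_left_mono[OF shift_decay[OF t] C_nonneg]] by (simp add: mult.assoc)
      qed
      also have "\<dots> = mass"
        unfolding mass_def by (rule infsum_cmult_right) (simp add: summable_exp_int)
      finally show "cmod (indicator {0..<1} t *
        ((\<Sum>j\<in>{- int N..<int N}. g (t + of_int j)) * fourier_char (- n) t)) \<le> mass" .
    qed
  qed (auto intro!: measurable_restrict_space1)
  have "(LINT t|unit_interval. periodization t * fourier_char (- n) t)
      = (LINT t|unit_interval. P t * fourier_char (- n) t)"
    by (rule Bochner_Integration.integral_cong) (auto simp: space_restrict_space P_def)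
  \<comment> \<open>The folded integrals omit only the point 1, a null set.\<close>
  also have "\<dots> = (LINT t|unit_interval. indicator {0..<1} t *
      (P t * fourier_char (- n) t))"
  proof (rule integral_cong_AE)
    have "AE t in unit_interval. t \<noteq> 1"
      using AE_lborel_singleton[of 1] by (subst AE_restrict_space_iff) auto
    moreover have "AE t in unit_interval. t \<in> {0..1}"
      by (rule AE_I2) (auto simp: space_restrict_space)
    ultimately show "AE t in unit_interval. P t * fourier_char (- n) t
        = indicator {0..<1} t * (P t * fourier_char (- n) t)"
      by eventually_elim (auto simp: indicator_def)
  qed (auto intro!: measurable_restrict_space1)
  also have "\<dots> = (LINT t|lborel. g t * fourier_char (- n) t)"
    by (rule LIMSEQ_unique[OF lim2 lim1])
  finally show ?thesis .
qed

text \<open>Chernoff's proof of pointwise convergence: dividing \<open>periodization t - periodization 0\<close> by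
  \<open>fourier_char 1 t - 1\<close> leaves a bounded function, whose Fourier coefficients tend to \<open>0\<close> by Bessel,
  and the Fourier coefficients of \<open>periodization\<close> are differences of consecutive ones of it.\<close>

theorem poisson_summation:
  assumes int: "integrable lborel g"
  shows "(\<lambda>N. \<Sum>n\<in>{- int N..<int N}. (LINT t|lborel. g t * fourier_char (- n) t))
           \<longlonglongrightarrow> (\<Sum>\<^sub>\<infinity>j::int. g (of_int j))"
proof -
  define P0 where "P0 = periodization 0"
  \<comment> \<open>The quotient is replaced by 0 at the end points, where its denominator
    vanishes.\<close>
  define Q where "Q = (\<lambda>t. indicator {0<..<1} t *\<^sub>R ((periodization t - P0) / (fourier_char 1 t - 1)))"
  define q where "q = (\<lambda>n. LINT t|unit_interval. Q t * fourier_char (- n) t)"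
  have nz: "fourier_char 1 t - 1 \<noteq> 0" if "0 < t" "t < 1" for t
    using norm_fourier_char_1_minus_1[of t] that by force
  have Q_meas [measurable]: "Q \<in> borel_measurable borel"
    unfolding Q_def
  proof (rule borel_measurable_continuous_on_indicator)
    show "continuous_on {0<..<1} (\<lambda>t. (periodization t - P0) / (fourier_char 1 t - 1))"
      using nz unfolding fourier_char_def
      by (intro continuous_intros continuous_on_subset[OF continuous_periodization]) auto
  qed simp
  \<comment> \<open>The periodization takes the value \<open>P0\<close> at both end points, so the
    distance to the nearer one can be used.\<close>
  have num: "cmod (periodization t - P0) \<le> lip * min t (1 - t)" if "0 \<le> t" "t \<le> 1" for t
    using periodization_lipschitz[of 0 t] periodization_lipschitz[of 1 t] that
    by (auto simp: P0_def periodization_1 min_def)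
  have Q_bd: "cmod (Q t) \<le> lip" for t
  proof (cases "0 < t \<and> t < 1")
    case True
    define m where "m = min t (1 - t)"
    have "0 < m" using True by (simp add: m_def)
    have D: "4 * m \<le> cmod (fourier_char 1 t - 1)"
      using norm_fourier_char_1_minus_1[of t] True by (simp add: m_def)
    have le: "cmod (periodization t - P0) \<le> lip * m"
      using num[of t] True by (simp add: m_def)
    then have "0 \<le> lip"
      using \<open>0 < m\<close> order_trans[OF norm_ge_zero le] by (simp add: zero_le_mult_iff)
    have "lip * m \<le> lip * cmod (fourier_char 1 t - 1)"
      using D \<open>0 < m\<close> by (intro mult_left_mono \<open>0 \<le> lip\<close>) linarith
    then show ?thesis
      using True le nz[of t] by (simp add: Q_def norm_divide divide_le_eq)
  next
    case False
    have "0 \<le> lip" using num[of "1/2"] order_trans[OF norm_ge_zero num[of "1/2"]] by simp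
    then show ?thesis using False by (auto simp: Q_def)
  qed
  have P_eq: "periodization t = P0 + Q t * fourier_char 1 t - Q t" if "0 \<le> t" "t \<le> 1" for t
  proof (cases "0 < t \<and> t < 1")
    case True
    then have "Q t * (fourier_char 1 t - 1) = periodization t - P0"
      using nz[of t] by (simp add: Q_def)
    then show ?thesis by (simp add: algebra_simps)
  next
    case False
    then have "t = 0 \<or> t = 1" using that by auto
    then show ?thesis by (auto simp: Q_def P0_def periodization_1)
  qed
  have iQ: "integrable unit_interval (\<lambda>t. Q t * fourier_char n t)" for n
    by (rule integrable_unit_intervalI[where B = lip]) (auto simp: norm_mult Q_bd)
  have ifc: "integrable unit_interval (\<lambda>t. P0 * fourier_char n t)" for n
    by (rule integrable_unit_intervalI[where B = "cmod P0"]) (auto simp: norm_mult)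
  have coeff: "(LINT t|lborel. g t * fourier_char (- n) t) = (if n = 0 then P0 else 0) + (q (n - 1) - q n)" for n
  proof -
    have "(LINT t|lborel. g t * fourier_char (- n) t)
        = (LINT t|unit_interval. periodization t * fourier_char (- n) t)"
      by (rule fourier_coeff_periodization[OF int, symmetric])
    also have "\<dots> = (LINT t|unit_interval. P0 * fourier_char (- n) t + (Q t * fourier_char (- (n - 1)) t - Q t * fourier_char (- n) t))"
    proof (rule Bochner_Integration.integral_cong[OF refl])
      fix t assume "t \<in> space unit_interval"
      then have t: "0 \<le> t" "t \<le> 1"
        by (auto simp: space_restrict_space)
      have "fourier_char (- (n - 1)) t = fourier_char 1 t * fourier_char (- n) t"
        using fourier_char_add[of 1 "- n" t] by simp
      then show "periodization t * fourier_char (- n) t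
          = P0 * fourier_char (- n) t + (Q t * fourier_char (- (n - 1)) t - Q t * fourier_char (- n) t)"
        unfolding P_eq[OF t] by (simp add: algebra_simps)
    qed
    also have "\<dots> = P0 * (LINT t|unit_interval. fourier_char (- n) t) + (q (n - 1) - q n)"
      unfolding q_def using iQ ifc
      by (subst Bochner_Integration.integral_add Bochner_Integration.integral_diff; (intro Bochner_Integration.integrable_diff)?; simp?)+
    also have "\<dots> = (if n = 0 then P0 else 0) + (q (n - 1) - q n)"
      by (simp add: integral_fourier_char)
    finally show ?thesis .
  qed
  have "(\<lambda>N. q (- int N - 1)) \<longlonglongrightarrow> 0" "(\<lambda>N. q (int N - 1)) \<longlonglongrightarrow> 0"
    unfolding q_def by (rule fourier_coeff_tendsto_0[OF Q_meas Q_bd]; simp add: inj_def)+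
  then have "(\<lambda>N. P0 + (q (- int N - 1) - q (int N - 1))) \<longlonglongrightarrow> P0 + (0 - 0)"
    by (intro tendsto_intros)
  moreover have "\<forall>\<^sub>F N in sequentially. P0 + (q (- int N - 1) - q (int N - 1))
      = (\<Sum>n\<in>{- int N..<int N}. (LINT t|lborel. g t * fourier_char (- n) t))"
    \<comment> \<open>For \<open>N \<ge> 1\<close> the range contains the index 0, which contributes
      \<open>P0\<close>; the rest telescopes.\<close>
    by (rule eventually_sequentiallyI[of 1]) (simp add: coeff sum.distrib sum_int_telescope)
  ultimately have "(\<lambda>N. \<Sum>n\<in>{- int N..<int N}. (LINT t|lborel. g t * fourier_char (- n) t)) \<longlonglongrightarrow> P0"
    by (simp add: tendsto_cong)
  then show ?thesis
    by (simp add: P0_def periodization_def)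
qed

end

section \<open>Hermite functions\<close>


text \<open>\<open>herm n t * exp (- 2 * pi * t\<^sup>2)\<close> is the \<open>n\<close>-th derivative of \<open>exp (- 2 * pi * t\<^sup>2)\<close>, over the
  reals and over the complex numbers alike.\<close>

fun herm :: "nat \<Rightarrow> 'a::real_normed_field \<Rightarrow> 'a" where
  "herm 0 t = 1"
| "herm (Suc n) t = - 4 * of_real pi * (t * herm n t + of_nat n * herm (n - 1) t)"

lemma herm_of_real: "herm n (of_real t) = of_real (herm n t)"
proof (induction n rule: less_induct)
  case (less n)
  then show ?case by (cases n) simp_all
qed

lemma herm_minus: "herm n (- t) = (-1) ^ n * herm n t"
proof (induction n rule: less_induct)
  case (less n)
  show ?case
  proof (cases n)
    case (Suc k)
    show ?thesis
    proof (cases k)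
      case (Suc l)
      then show ?thesis
        using \<open>n = Suc k\<close> less.IH[of k] less.IH[of l]
        by (simp add: herm.simps(2)[of "Suc l"] algebra_simps del: herm.simps)
    qed (simp add: \<open>n = Suc k\<close>)
  qed simp
qed

text \<open>Differentiation lowers the index, which is why the three-term recurrence produces the
  next derivative of the Gaussian. At \<open>n = 0\<close> the truncated index \<open>n - 1\<close>
  is harmless, its factor being 0.\<close>

lemma has_field_derivative_herm:
  "(herm n has_field_derivative - 4 * of_real pi * of_nat n * herm (n - 1) t) (at t)"
proof (induction n rule: less_induct)
  case (less n)
  have eq: "herm (Suc k) = (\<lambda>t::'a. - 4 * of_real pi * (t * herm k t + of_nat k * herm (k - 1) t))" for k
    by (simp add: fun_eq_iff)
  consider "n = 0" | "n = Suc 0" | l where "n = Suc (Suc l)"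
    by (metis not0_implies_Suc)
  then show ?case
  proof cases
    case 1
    have "herm 0 = (\<lambda>t::'a. 1)" by (simp add: fun_eq_iff)
    then show ?thesis using 1 by simp
  next
    case 2
    then show ?thesis
      unfolding 2 eq by (auto intro!: derivative_eq_intros)
  next
    case (3 l)
    let ?D = "\<lambda>k. - 4 * of_real pi * of_nat k * herm (k - 1) t"
    have "((\<lambda>t. - 4 * of_real pi * (t * herm (Suc l) t + of_nat (Suc l) * herm l t)) has_field_derivative
        - 4 * of_real pi * (herm (Suc l) t + (t * ?D (Suc l) + of_nat (Suc l) * ?D l))) (at t)"
      using 3 by (intro DERIV_cmult) (auto intro!: derivative_eq_intros less.IH simp: algebra_simps simp del: herm.simps)
    also have "t * ?D (Suc l) + of_nat (Suc l) * ?D l = of_nat (Suc l) * herm (Suc l) t"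
      by (simp add: algebra_simps)
    finally show ?thesis
      unfolding 3 eq[of "Suc l"] by (simp add: algebra_simps del: herm.simps)
  qed
qed

lemma has_field_derivative_herm_gaussian:
  fixes t c :: "'a::{banach, real_normed_field}"
  shows "((\<lambda>t. herm n (t - c) * exp (- 2 * of_real pi * (t - c)\<^sup>2)) has_field_derivative
           herm (Suc n) (t - c) * exp (- 2 * of_real pi * (t - c)\<^sup>2)) (at t)"
  by (auto intro!: derivative_eq_intros DERIV_chain2[OF has_field_derivative_herm])
     (simp add: algebra_simps)

text \<open>Each step of the recurrence multiplies by \<open>t\<close>, and
  \<open>\<bar>t\<bar> \<le> exp \<bar>t\<bar>\<close> raises the rate by one. Such growth is crude
  for a polynomial but is absorbed by the Gaussian.\<close>

lemma herm_exp_bound: "\<exists>K\<ge>0. \<forall>t::real. \<bar>herm n t\<bar> \<le> K * exp (n * \<bar>t\<bar>)"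
proof (induction n rule: less_induct)
  case (less n)
  show ?case
  proof (cases n)
    case 0
    then show ?thesis by (intro exI[of _ 1]) simp
  next
    case (Suc k)
    define l where "l = k - 1"
    have herm_n: "herm n t = - 4 * pi * (t * herm k t + k * herm l t)" for t :: real
      by (simp add: Suc l_def)
    obtain K where K: "K \<ge> 0" "\<And>t::real. \<bar>herm k t\<bar> \<le> K * exp (k * \<bar>t\<bar>)"
      using less.IH[of k] Suc by auto
    have "l < n" by (simp add: l_def Suc)
    then obtain L where L: "L \<ge> 0" "\<And>t::real. \<bar>herm l t\<bar> \<le> L * exp (l * \<bar>t\<bar>)"
      using less.IH[of l] by blast
    have "\<bar>herm n t\<bar> \<le> 4 * pi * (K + k * L) * exp (n * \<bar>t\<bar>)" for t :: real
    proof -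
      have "\<bar>t\<bar> * \<bar>herm k t\<bar> \<le> exp \<bar>t\<bar> * (K * exp (k * \<bar>t\<bar>))"
      proof (rule mult_mono)
        show "\<bar>t\<bar> \<le> exp \<bar>t\<bar>"
          using exp_ge_add_one_self[of "\<bar>t\<bar>"] by linarith
      qed (use K in auto)
      also have "\<dots> = K * exp (n * \<bar>t\<bar>)"
        by (simp add: Suc mult_exp_exp algebra_simps)
      finally have 1: "\<bar>t\<bar> * \<bar>herm k t\<bar> \<le> K * exp (n * \<bar>t\<bar>)" .
      have "\<bar>herm l t\<bar> \<le> L * exp (n * \<bar>t\<bar>)"
        by (rule order_trans[OF L(2)]) (auto intro!: mult_left_mono L mult_right_mono simp: Suc l_def)
      then have 2: "k * \<bar>herm l t\<bar> \<le> k * (L * exp (n * \<bar>t\<bar>))"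
        by (rule mult_left_mono) simp
      have "\<bar>t * herm k t + k * herm l t\<bar> \<le> K * exp (n * \<bar>t\<bar>) + k * (L * exp (n * \<bar>t\<bar>))"
        using 1 2 by (intro order_trans[OF abs_triangle_ineq] add_mono) (simp_all add: abs_mult)
      then have "4 * pi * \<bar>t * herm k t + k * herm l t\<bar> \<le> 4 * pi * (K * exp (n * \<bar>t\<bar>) + k * (L * exp (n * \<bar>t\<bar>)))"
        by (rule mult_left_mono) simp
      moreover have "\<bar>herm n t\<bar> = 4 * pi * \<bar>t * herm k t + k * herm l t\<bar>"
        unfolding herm_n abs_mult by simp
      ultimately show ?thesis
        by (simp add: algebra_simps)
    qed
    then show ?thesis
      using K L by (intro exI[of _ "4 * pi * (K + k * L)"]) auto
  qed
qed

section \<open>Hermite functions as decaying windows\<close>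

lemma hermite_fun_eq:
  "hermite_fun n t = of_real ((-1) ^ n * hermite_const n * herm n t * exp (- pi * t\<^sup>2))"
proof -
  have "(deriv ^^ n) (\<lambda>s::real. exp (- 2 * pi * s\<^sup>2)) = (\<lambda>s. herm n s * exp (- 2 * pi * s\<^sup>2))"
  proof (induction n)
    case (Suc n)
    show ?case
      using has_field_derivative_herm_gaussian[of n "0::real"]
      unfolding funpow.simps comp_apply Suc.IH
      by (auto simp: fun_eq_iff intro!: DERIV_imp_deriv simp del: herm.simps)
  qed simp
  moreover have "exp (pi * t\<^sup>2) * exp (- 2 * pi * t\<^sup>2) = exp (- pi * t\<^sup>2)"
    by (simp add: mult_exp_exp)
  ultimately show ?thesis
    unfolding hermite_fun_def by (simp add: mult_ac)
qed

lemma decaying_window_hermite: "\<exists>C. decaying_window (hermite_fun n) C"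
proof -
  obtain K where K: "K \<ge> 0" "\<And>t::real. \<bar>herm n t\<bar> \<le> K * exp (n * \<bar>t\<bar>)"
    using herm_exp_bound by blast
  define c where "c = \<bar>hermite_const n\<bar>"
  have "continuous_on UNIV (herm n :: real \<Rightarrow> real)"
    by (intro continuous_at_imp_continuous_on ballI DERIV_isCont[OF has_field_derivative_herm])
  then have "continuous_on UNIV (hermite_fun n)"
    unfolding hermite_fun_eq[abs_def] by (intro continuous_intros)
  moreover have "cmod (hermite_fun n t) \<le> (c * K * exp ((real n + 2)\<^sup>2)) * exp (- 2 * \<bar>t\<bar>)" for t
  proof -
    have "cmod (hermite_fun n t) = c * \<bar>herm n t\<bar> * exp (- pi * t\<^sup>2)"
      unfolding hermite_fun_eq norm_of_real by (simp add: abs_mult c_def power_abs)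
    also have "\<dots> \<le> c * (K * exp (n * \<bar>t\<bar>)) * exp (- pi * t\<^sup>2)"
      by (intro mult_right_mono mult_left_mono K) (auto simp: c_def)
    also have "\<dots> = c * K * exp (n * \<bar>t\<bar> - pi * t\<^sup>2)"
      by (simp add: exp_diff exp_minus field_simps)
    also have "\<dots> \<le> c * K * exp ((real n + 2)\<^sup>2 - 2 * \<bar>t\<bar>)"
    proof -
      have "1 * t\<^sup>2 \<le> pi * t\<^sup>2"
        using pi_gt3 by (intro mult_right_mono) auto
      \<comment> \<open>Completing the square absorbs both the growth
        \<open>n * \<bar>t\<bar>\<close> of the polynomial factor and the required rate
        \<open>2 * \<bar>t\<bar>\<close>; this is the source of the constant
        \<open>exp ((real n + 2)\<^sup>2)\<close>.\<close>
      moreover have "0 \<le> (\<bar>t\<bar> - (real n + 2) / 2)\<^sup>2"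
        by simp
      then have "(real n + 2) * \<bar>t\<bar> \<le> t\<^sup>2 + (real n + 2)\<^sup>2 / 4"
        by (simp add: power2_diff power_divide mult.commute[of _ "\<bar>t\<bar>"])
      moreover have "(real n + 2)\<^sup>2 / 4 \<le> (real n + 2)\<^sup>2"
        by simp
      ultimately have "n * \<bar>t\<bar> - pi * t\<^sup>2 \<le> (real n + 2)\<^sup>2 - 2 * \<bar>t\<bar>"
        unfolding distrib_right by linarith
      then show ?thesis
        using K by (intro mult_left_mono) (auto simp: c_def)
    qed
    also have "\<dots> = (c * K * exp ((real n + 2)\<^sup>2)) * exp (- 2 * \<bar>t\<bar>)"
      by (simp add: exp_diff exp_minus field_simps)
    finally show ?thesis .
  qed
  ultimately show ?thesis
    by (auto simp: decaying_window_def)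
qed

text \<open>Read off from the characteristic function of the standard normal distribution. The
  substitution \<open>u = r * (t - x)\<close> with \<open>r = sqrt (2 * pi)\<close> normalises the
  Gaussian, and the frequency \<open>- n * r\<close> then yields the phase
  \<open>2 * pi * n * (x - t)\<close>.\<close>

lemma fourier_gaussian:
  "(LINT t|lborel. exp (- of_real pi * (of_real t - of_real x)\<^sup>2) * fourier_char (- n) t)
     = exp (- of_real pi * (of_int n)\<^sup>2 - 2 * of_real pi * \<i> * of_int n * of_real x :: complex)"
proof -
  define r where "r = sqrt (2 * pi)"
  have r: "r > 0" "r\<^sup>2 = 2 * pi" by (simp_all add: r_def)
  define y where "y = - (of_int n * r)"
  have "char std_normal_distribution y = (LINT u|lborel. of_real (std_normal_density u) * iexp (y * u))"
    unfolding char_def by (subst integral_density) (auto simp: scaleR_conv_of_real)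
  also have "\<dots> = r *\<^sub>R (LINT t|lborel. of_real (std_normal_density (- r * x + r * t)) * iexp (y * (- r * x + r * t)))"
    using r by (subst lborel_integral_real_affine[where c = r and t = "- r * x"]) auto
  also have "\<dots> = (LINT t|lborel. of_real r * (of_real (std_normal_density (- r * x + r * t)) * iexp (y * (- r * x + r * t))))"
    by (simp add: scaleR_conv_of_real)
  also have "\<dots> = (LINT t|lborel. exp (2 * of_real pi * \<i> * of_int n * of_real x) *
      (exp (- of_real pi * (of_real t - of_real x)\<^sup>2) * fourier_char (- n) t))"
  proof (rule Bochner_Integration.integral_cong[OF refl])
    fix t
    have "- r * x + r * t = r * (t - x)" by (simp add: algebra_simps)
    then have e1: "r * std_normal_density (- r * x + r * t) = exp (- pi * (t - x)\<^sup>2)"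
      using r by (simp add: std_normal_density_def power_mult_distrib r_def[symmetric])
    have e2: "y * (- r * x + r * t) = 2 * pi * n * x - 2 * pi * n * t"
    proof -
      have "y * (- r * x + r * t) = r\<^sup>2 * (n * x - n * t)"
        by (simp add: y_def power2_eq_square algebra_simps)
      then show ?thesis by (simp add: r algebra_simps)
    qed
    have "of_real r * (of_real (std_normal_density (- r * x + r * t)) * iexp (y * (- r * x + r * t)))
        = of_real (r * std_normal_density (- r * x + r * t)) * iexp (y * (- r * x + r * t))"
      by simp
    also have "\<dots> = of_real (exp (- pi * (t - x)\<^sup>2)) * iexp (2 * pi * n * x - 2 * pi * n * t)"
      by (simp only: e1 e2)
    also have "\<dots> = exp (2 * of_real pi * \<i> * of_int n * of_real x) *
      (exp (- of_real pi * (of_real t - of_real x)\<^sup>2) * fourier_char (- n) t)"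
      by (simp add: fourier_char_def cis_conv_exp exp_of_real[symmetric] mult_exp_exp algebra_simps)
    finally show "of_real r * (of_real (std_normal_density (- r * x + r * t)) * iexp (y * (- r * x + r * t)))
      = exp (2 * of_real pi * \<i> * of_int n * of_real x) *
      (exp (- of_real pi * (of_real t - of_real x)\<^sup>2) * fourier_char (- n) t)" .
  qed
  also have "\<dots> = exp (2 * of_real pi * \<i> * of_int n * of_real x) *
      (LINT t|lborel. exp (- of_real pi * (of_real t - of_real x)\<^sup>2) * fourier_char (- n) t)"
    by simp
  finally have "exp (2 * of_real pi * \<i> * of_int n * of_real x) *
      (LINT t|lborel. exp (- of_real pi * (of_real t - of_real x)\<^sup>2) * fourier_char (- n) t)
      = char std_normal_distribution y" ..
  also have "\<dots> = of_real (exp (- pi * (of_int n)\<^sup>2))"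
    by (simp add: char_std_normal_distribution y_def power_mult_distrib r)
  finally show ?thesis
    by (simp add: exp_diff exp_of_real[symmetric] field_simps)
qed

section \<open>The theta function\<close>


text \<open>Summed over \<open>k\<close>, this is \<open>exp (- 2 * pi * s\<^sup>2)\<close> times
  the Jacobi theta series \<open>\<Sum>k. exp (- pi * k\<^sup>2 + 2 * pi * \<i> * k * z)\<close> at
  \<open>z = - 2 * \<i> * s\<close>.\<close>

definition theta_term :: "complex \<Rightarrow> int \<Rightarrow> complex" where
  "theta_term s k = exp (- of_real pi * (of_int k)\<^sup>2 + 4 * of_real pi * of_int k * s - 2 * of_real pi * s\<^sup>2)"

definition theta :: "complex \<Rightarrow> complex" where
  "theta s = (\<Sum>\<^sub>\<infinity>k. theta_term s k)"

lemma norm_theta_term_le: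
  assumes "s \<in> ball 0 1"
  shows "cmod (theta_term s k) \<le> exp (9 * pi) * exp (- \<bar>of_int k\<bar>)"
proof -
  have s: "cmod s \<le> 1" using assms by simp
  have "k * Re s \<le> \<bar>k * Re s\<bar>"
    by (rule abs_ge_self)
  also have "\<dots> = \<bar>k\<bar> * \<bar>Re s\<bar>"
    by (simp add: abs_mult)
  also have "\<dots> \<le> real_of_int \<bar>k\<bar> * 1"
    using abs_Re_le_cmod[of s] s by (intro mult_left_mono) (linarith, simp)
  finally have 1: "4 * pi * (k * Re s) \<le> 4 * pi * \<bar>k\<bar>"
    by simp
  have "- Re (s\<^sup>2) \<le> 1"
    using abs_Re_le_cmod[of "s\<^sup>2"] s power_mono[of "cmod s" 1 2] by (simp add: norm_power)
  then have 2: "2 * pi * (- Re (s\<^sup>2)) \<le> 2 * pi * 1"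
    by (intro mult_left_mono) auto
  \<comment> \<open>Of the \<open>5 * pi * \<bar>k\<bar>\<close> obtained here, four parts cancel
    the linear term and one gives the decay in \<open>k\<close>. The leftover
    \<open>25 / 4 * pi\<close> and the \<open>2 * pi\<close> from \<open>s\<^sup>2\<close> fit into
    \<open>9 * pi\<close>.\<close>
  have "0 \<le> pi * (\<bar>of_int k\<bar> - 5 / 2)\<^sup>2"
    by simp
  then have 3: "5 * pi * \<bar>k\<bar> \<le> pi * (of_int k)\<^sup>2 + 25 / 4 * pi"
    by (simp add: power2_diff algebra_simps power2_eq_square)
  have 4: "1 * \<bar>real_of_int k\<bar> \<le> pi * \<bar>real_of_int k\<bar>"
    using pi_gt3 by (intro mult_right_mono) auto
  have "Re (- of_real pi * (of_int k)\<^sup>2 + 4 * of_real pi * of_int k * s - 2 * of_real pi * s\<^sup>2)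
      = - pi * (of_int k)\<^sup>2 + 4 * pi * (k * Re s) + 2 * pi * (- Re (s\<^sup>2))"
    by (simp add: power2_eq_square algebra_simps)
  also have "\<dots> \<le> 9 * pi - \<bar>k\<bar>"
    using 1 2 3 4 pi_gt_zero by linarith
  finally have "cmod (theta_term s k) \<le> exp (9 * pi - \<bar>k\<bar>)"
    unfolding theta_term_def norm_exp_eq_Re by simp
  then show ?thesis
    by (simp add: exp_diff exp_minus field_simps)
qed

lemma summable_theta_majorant: "(\<lambda>k::int. exp (9 * pi) * exp (- \<bar>of_int k\<bar>)) summable_on UNIV"
  by (intro summable_on_cmult_right summable_exp_int)

lemma has_sum_theta:
  assumes "s \<in> ball 0 1"
  shows "(theta_term s has_sum theta s) UNIV"
proof -
  have "(\<lambda>k. cmod (theta_term s k)) summable_on UNIV"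
    by (rule summable_on_comparison_test[OF summable_theta_majorant norm_theta_term_le[OF assms]]) auto
  then show ?thesis
    unfolding theta_def by (rule has_sum_infsum[OF abs_summable_summable])
qed

lemma uniform_limit_theta:
  "uniform_limit (ball 0 1) (\<lambda>K s. \<Sum>k\<in>K. theta_term s k) theta (finite_subsets_at_top UNIV)"
  by (rule Weierstrass_m_test_general'[where M = "\<lambda>k. exp (9 * pi) * exp (- \<bar>of_int k\<bar>)"])
     (use norm_theta_term_le has_sum_theta summable_theta_majorant in blast)+

lemma holomorphic_theta: "theta holomorphic_on ball 0 1"
proof (rule holomorphic_uniform_sequence)
  fix N :: nat
  show "(\<lambda>s. \<Sum>k\<in>{- int N..<int N}. theta_term s k) holomorphic_on ball 0 1"
    unfolding theta_term_def by (intro holomorphic_intros)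
next
  fix s :: complex assume "s \<in> ball 0 1"
  then obtain d where d: "0 < d" "cball s d \<subseteq> ball 0 1"
    using open_contains_cball by blast
  have "uniform_limit (cball s d) (\<lambda>N s. \<Sum>k\<in>{- int N..<int N}. theta_term s k) theta sequentially"
    using filterlim_compose[OF uniform_limit_on_subset[OF uniform_limit_theta d(2)] filterlim_symmetric_int_interval] .
  with d show "\<exists>d>0. cball s d \<subseteq> ball 0 1 \<and>
      uniform_limit (cball s d) (\<lambda>N s. \<Sum>k\<in>{- int N..<int N}. theta_term s k) theta sequentially"
    by blast
qed simp

text \<open>Each \<open>theta_term s k\<close> is a multiple of the shifted Gaussian \<open>exp (- 2 * pi * (s - k)\<^sup>2)\<close>.\<close>

lemma higher_deriv_theta_term_sum:
  "(deriv ^^ n) (\<lambda>s. \<Sum>k\<in>K. theta_term s k)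
     = (\<lambda>s. \<Sum>k\<in>K. exp (of_real pi * (of_int k)\<^sup>2) * (herm n (s - of_int k) * exp (- 2 * of_real pi * (s - of_int k)\<^sup>2)))"
proof (induction n)
  case 0
  have "theta_term s k = exp (of_real pi * (of_int k)\<^sup>2) * exp (- 2 * of_real pi * (s - of_int k)\<^sup>2)" for s k
    unfolding theta_term_def mult_exp_exp
    by (rule arg_cong[where f = exp]) (simp add: power2_eq_square algebra_simps)
  then show ?case by simp
next
  case (Suc n)
  show ?case
    unfolding funpow.simps comp_apply Suc.IH
    by (rule ext, rule DERIV_imp_deriv, intro DERIV_sum DERIV_cmult has_field_derivative_herm_gaussian)
qed

text \<open>Uniform limits of holomorphic functions may be differentiated termwise. At 0 the factors
  \<open>exp (pi * k\<^sup>2)\<close> and \<open>exp (- 2 * pi * k\<^sup>2)\<close> combine to the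
  Gaussian of the Hermite function.\<close>

lemma has_sum_higher_deriv_theta:
  "((\<lambda>k. herm n (- of_int k) * exp (- of_real pi * (of_int k)\<^sup>2)) has_sum (deriv ^^ n) theta 0) UNIV"
proof -
  have "((\<lambda>K. (deriv ^^ n) (\<lambda>s. \<Sum>k\<in>K. theta_term s k) 0) \<longlongrightarrow> (deriv ^^ n) theta 0) (finite_subsets_at_top UNIV)"
  proof (rule higher_deriv_complex_uniform_limit[OF uniform_limit_theta])
    show "\<forall>\<^sub>F K in finite_subsets_at_top UNIV. (\<lambda>s. \<Sum>k\<in>K. theta_term s k) holomorphic_on ball 0 1"
      unfolding theta_term_def by (intro always_eventually allI holomorphic_intros)
  qed auto
  moreover have eq: "exp (of_real pi * (of_int k)\<^sup>2) * (herm n (0 - of_int k) * exp (- 2 * of_real pi * (0 - of_int k)\<^sup>2))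
      = herm n (- of_int k) * exp (- of_real pi * (of_int k)\<^sup>2 :: complex)" for k :: int
    by (simp add: mult.left_commute mult_exp_exp)
  ultimately show ?thesis
    unfolding has_sum_def higher_deriv_theta_term_sum eq by blast
qed

section \<open>Functional equation of theta\<close>

lemma smooth_decaying_gaussian:
  fixes x :: real
  defines "g \<equiv> \<lambda>t. exp (- of_real pi * (of_real t - of_real x)\<^sup>2) :: complex"
  shows "smooth_decaying g (exp (2 * \<bar>x\<bar> + 1)) (\<lambda>t. - 2 * of_real pi * (of_real t - of_real x) * g t) (2 * pi * exp (2 * \<bar>x\<bar> + 3))"
proof
  have g_norm: "cmod (g t) = exp (- pi * (t - x)\<^sup>2)" for t
  proof -
    have "g t = of_real (exp (- pi * (t - x)\<^sup>2))"
      by (simp add: g_def exp_of_real[symmetric])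
    then show ?thesis by (simp only: norm_of_real abs_exp_cancel)
  qed
  have sq: "u\<^sup>2 \<le> pi * u\<^sup>2" for u :: real
    using pi_gt3 mult_right_mono[of 1 pi "u\<^sup>2"] by simp
  show "continuous_on UNIV g"
    unfolding g_def by (intro continuous_intros)
  show "cmod (g t) \<le> exp (2 * \<bar>x\<bar> + 1) * exp (- 2 * \<bar>t\<bar>)" for t
  proof -
    have "0 \<le> (\<bar>t - x\<bar> - 1)\<^sup>2" by simp
    then have "2 * \<bar>t - x\<bar> \<le> (t - x)\<^sup>2 + 1"
      by (simp add: power2_diff)
    then have "2 * \<bar>t - x\<bar> \<le> pi * (t - x)\<^sup>2 + 1"
      using sq[of "t - x"] by linarith
    moreover have "\<bar>t\<bar> \<le> \<bar>t - x\<bar> + \<bar>x\<bar>"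
      by linarith
    ultimately have "- pi * (t - x)\<^sup>2 \<le> 2 * \<bar>x\<bar> + 1 + - 2 * \<bar>t\<bar>"
      by simp
    then show ?thesis
      unfolding g_norm mult_exp_exp by simp
  qed
  show "(g has_vector_derivative - 2 * of_real pi * (of_real t - of_real x) * g t) (at t)" for t
    unfolding g_def
    by (rule has_vector_derivative_real_field) (auto intro!: derivative_eq_intros)
  show "cmod (- 2 * of_real pi * (of_real t - of_real x) * g t) \<le> 2 * pi * exp (2 * \<bar>x\<bar> + 3) * exp (- 2 * \<bar>t\<bar>)" for t
  proof -
    \<comment> \<open>The rate is 3 instead of 2 because the factor \<open>\<bar>t - x\<bar>\<close>
      of the derivative is bounded by \<open>exp \<bar>t - x\<bar>\<close>; \<open>9 / 4\<close> is
      rounded up to 3.\<close>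
    have "0 \<le> (\<bar>t - x\<bar> - 3 / 2)\<^sup>2" by simp
    then have "3 * \<bar>t - x\<bar> \<le> (t - x)\<^sup>2 + 9 / 4"
      by (simp add: power2_diff power_divide)
    then have "3 * \<bar>t - x\<bar> \<le> pi * (t - x)\<^sup>2 + 3"
      using sq[of "t - x"] by linarith
    moreover have "\<bar>t\<bar> \<le> \<bar>t - x\<bar> + \<bar>x\<bar>"
      by linarith
    ultimately have le: "\<bar>t - x\<bar> + - pi * (t - x)\<^sup>2 \<le> 2 * \<bar>x\<bar> + 3 + - 2 * \<bar>t\<bar>"
      by simp
    have "cmod (- 2 * of_real pi * (of_real t - of_real x) * g t) = 2 * pi * (\<bar>t - x\<bar> * exp (- pi * (t - x)\<^sup>2))"
      by (simp add: norm_mult g_norm flip: of_real_diff)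
    also have "\<bar>t - x\<bar> * exp (- pi * (t - x)\<^sup>2) \<le> exp \<bar>t - x\<bar> * exp (- pi * (t - x)\<^sup>2)"
    proof (rule mult_right_mono)
      show "\<bar>t - x\<bar> \<le> exp \<bar>t - x\<bar>"
        using exp_ge_add_one_self[of "\<bar>t - x\<bar>"] by linarith
    qed simp
    also have "\<dots> \<le> exp (2 * \<bar>x\<bar> + 3) * exp (- 2 * \<bar>t\<bar>)"
      using le unfolding mult_exp_exp by simp
    finally show ?thesis by (simp add: mult_ac)
  qed
qed

lemma integrable_gaussian:
  "integrable lborel (\<lambda>t. exp (- of_real pi * (of_real t - of_real x)\<^sup>2) :: complex)"
proof -
  have "integrable lborel (normal_density x (1 / sqrt (2 * pi)))"
    by (rule integrable_normal_density) simp
  then have "integrable lborel (\<lambda>t. complex_of_real (normal_density x (1 / sqrt (2 * pi)) t))"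
    by simp
  moreover have "complex_of_real (normal_density x (1 / sqrt (2 * pi)) t) = exp (- of_real pi * (of_real t - of_real x)\<^sup>2)" for t
    by (simp add: normal_density_def power_divide exp_of_real[symmetric] mult.commute)
  ultimately show ?thesis by simp
qed

text \<open>Poisson summation for the Gaussian centred at \<open>x = 2 * s\<close>. Completing the
  square shows that the values at the integers sum to \<open>theta s\<close> and their Fourier side
  to \<open>theta (- \<i> * s)\<close>, with the same factor
  \<open>c = exp (2 * pi * s\<^sup>2)\<close> on both sides. Real \<open>s\<close> keeps the centre
  on the line.\<close>

lemma theta_imaginary:
  assumes "\<bar>s\<bar> < 1"
  shows "theta (of_real s) = theta (- \<i> * of_real s)"
proof -
  define x where "x = 2 * s"
  interpret smooth_decaying "\<lambda>t. exp (- of_real pi * (of_real t - of_real x)\<^sup>2)"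
      "exp (2 * \<bar>x\<bar> + 1)" "\<lambda>t. - 2 * of_real pi * (of_real t - of_real x) * exp (- of_real pi * (of_real t - of_real x)\<^sup>2)"
      "2 * pi * exp (2 * \<bar>x\<bar> + 3)"
    by (rule smooth_decaying_gaussian)
  define c where "c = exp (2 * of_real pi * (of_real s)\<^sup>2 :: complex)"
  have in_ball: "of_real s \<in> ball (0::complex) 1" "- \<i> * of_real s \<in> ball (0::complex) 1"
    using assms by (auto simp: norm_mult)
  have t1: "theta_term (of_real s) k = c * exp (- of_real pi * (of_real (of_int k) - of_real x)\<^sup>2)" for k
    unfolding theta_term_def c_def mult_exp_exp
    by (rule arg_cong[where f = exp]) (simp add: x_def power2_eq_square algebra_simps)
  have t2: "theta_term (- \<i> * of_real s) k
      = c * exp (- of_real pi * (of_int k)\<^sup>2 - 2 * of_real pi * \<i> * of_int k * of_real x)" for k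
    unfolding theta_term_def c_def mult_exp_exp
    by (rule arg_cong[where f = exp]) (simp add: x_def power2_eq_square algebra_simps)
  have "(\<lambda>N. c * (\<Sum>n\<in>{- int N..<int N}. exp (- of_real pi * (of_int n)\<^sup>2 - 2 * of_real pi * \<i> * of_int n * of_real x)))
      \<longlonglongrightarrow> c * (\<Sum>\<^sub>\<infinity>k. exp (- of_real pi * (of_real (of_int k) - of_real x)\<^sup>2))"
    using poisson_summation[OF integrable_gaussian] unfolding fourier_gaussian by (intro tendsto_intros)
  then have "(\<lambda>N. \<Sum>n\<in>{- int N..<int N}. theta_term (- \<i> * of_real s) n) \<longlonglongrightarrow> theta (of_real s)"
    unfolding theta_def t1 t2 by (simp add: infsum_cmult_right' sum_distrib_left)
  moreover have "(\<lambda>N. \<Sum>n\<in>{- int N..<int N}. theta_term (- \<i> * of_real s) n) \<longlonglongrightarrow> theta (- \<i> * of_real s)"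
    using has_sum_theta[OF in_ball(2)] unfolding has_sum_def
    by (rule filterlim_compose[OF _ filterlim_symmetric_int_interval])
  ultimately show ?thesis
    by (rule LIMSEQ_unique)
qed

text \<open>Identity theorem: the two sides are holomorphic on the unit disc and agree on the
  segment \<open>(0, 1)\<close>, which accumulates at 0.\<close>

lemma theta_rotate:
  assumes "s \<in> ball 0 1"
  shows "theta s = theta (- \<i> * s)"
proof -
  have ball: "- \<i> * w \<in> ball 0 1" if "w \<in> ball 0 1" for w :: complex
    using that by (simp add: norm_mult)
  have "theta s - theta (- \<i> * s) = 0"
  proof (rule analytic_continuation[where f = "\<lambda>s. theta s - theta (- \<i> * s)" and w = s and S = "ball 0 1" and U = "of_real ` {0<..<1}" and \<xi> = 0])
    show "(\<lambda>s. theta s - theta (- \<i> * s)) holomorphic_on ball 0 1"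
      using ball by (intro holomorphic_intros holomorphic_theta
          holomorphic_on_compose_gen[OF _ holomorphic_theta, unfolded o_def]) auto
    show "(0::complex) islimpt of_real ` {0<..<1}"
    proof (rule islimptI)
      fix T :: "complex set" assume "0 \<in> T" "open T"
      then obtain e where e: "e > 0" "ball 0 e \<subseteq> T"
        using open_contains_ball by blast
      then have "of_real (min (e / 2) (1 / 2)) \<in> T"
        by (auto simp: subset_iff)
      then show "\<exists>y\<in>of_real ` {0<..<1}. y \<in> T \<and> y \<noteq> (0::complex)"
        using e by (intro bexI[of _ "of_real (min (e / 2) (1 / 2))"]) auto
    qed
  qed (use assms theta_imaginary in \<open>auto\<close>)
  then show ?thesis by simp
qed

text \<open>By the chain rule the symmetry multiplies this derivative by
  \<open>(- \<i>) ^ (4 * m + 2) = -1\<close>, so it equals its own negative.\<close>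

lemma higher_deriv_theta_eq_0: "(deriv ^^ (4 * m + 2)) theta 0 = 0"
proof -
  have "(deriv ^^ (4 * m + 2)) theta 0 = (deriv ^^ (4 * m + 2)) (\<lambda>w. theta (- \<i> * w)) 0"
  proof (rule higher_deriv_cong_ev)
    have "\<forall>\<^sub>F s in nhds 0. s \<in> ball (0::complex) 1"
      by (intro eventually_nhds_in_open) auto
    then show "\<forall>\<^sub>F s in nhds 0. theta s = theta (- \<i> * s)"
      by eventually_elim (rule theta_rotate)
  qed simp
  also have "\<dots> = (- \<i>) ^ (4 * m + 2) * (deriv ^^ (4 * m + 2)) theta (- \<i> * 0)"
    by (rule higher_deriv_compose_linear[OF holomorphic_theta, where S = "ball 0 1"]) (auto simp: norm_mult)
  also have "(- \<i>) ^ (4 * m + 2) = -1"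
    by (simp add: power_add power_mult)
  finally show ?thesis by simp
qed

section \<open>Common zeros of the Zak transform\<close>


text \<open>The derivative formula evaluates \<open>herm n\<close> at \<open>- k\<close>; since
  \<open>n\<close> is even, this is the value at \<open>k\<close>, and the sign
  \<open>(-1) ^ n\<close> of the Hermite function disappears. Conjugation does not affect the real
  values.\<close>

lemma hermite_zak_at_origin: "(\<Sum>\<^sub>\<infinity>j. zak_term (hermite_fun (4 * m + 2)) 0 0 j) = 0"
proof -
  define n where "n = 4 * m + 2"
  have "((\<lambda>k. herm n (- of_int k) * exp (- of_real pi * (of_int k)\<^sup>2)) has_sum (0::complex)) UNIV"
    using has_sum_higher_deriv_theta[of n] higher_deriv_theta_eq_0[of m] by (simp add: n_def)
  then have "((\<lambda>k. complex_of_real (hermite_const n) * (herm n (- of_int k) * exp (- of_real pi * (of_int k)\<^sup>2))) has_sum (complex_of_real (hermite_const n) * (0::complex))) UNIV"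
    by (rule has_sum_cmult_right)
  moreover have "zak_term (hermite_fun n) 0 0 k = complex_of_real (hermite_const n) * (herm n (- of_int k) * exp (- of_real pi * (of_int k)\<^sup>2))" for k
  proof -
    have "zak_term (hermite_fun n) 0 0 k = of_real (hermite_const n * herm n (of_int k) * exp (- pi * (of_int k)\<^sup>2))"
      by (simp add: zak_term_def hermite_fun_eq n_def del: of_real_mult)
    also have "\<dots> = complex_of_real (hermite_const n) * (of_real (herm n (of_int k)) * exp (- of_real pi * (of_int k)\<^sup>2))"
      by (simp add: exp_of_real[symmetric])
    also have "of_real (herm n (of_int k)) = herm n (- of_int k :: complex)"
      unfolding herm_minus by (simp add: n_def flip: herm_of_real)
    finally show ?thesis .
  qed
  ultimately show ?thesis
    unfolding n_def[symmetric] by (simp add: infsumI)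
qed

text \<open>The reflection of \<open>j\<close> to \<open>1 - j\<close> sends \<open>j - 1/2\<close>
  to its negative, which leaves \<open>g\<close> unchanged, and reverses the sign of
  \<open>cis (- pi * j)\<close>. The sum therefore equals its own negative.\<close>

lemma even_zak_at_half:
  assumes even: "\<And>t. g (- t) = g t"
  shows "(\<Sum>\<^sub>\<infinity>j. zak_term g (1/2) 0 j) = 0"
proof -
  have "zak_term g (1/2) 0 (1 - j) = - zak_term g (1/2) 0 j" for j
  proof -
    have "cis (- pi * of_int (1 - j)) = cis (- pi) * (cis (2 * pi * of_int j) * cis (- pi * of_int j))"
      unfolding cis_mult by (rule arg_cong[where f = cis]) (simp add: algebra_simps)
    also have "\<dots> = - cis (- pi * of_int j)"
      by (simp add: cis_multiple_2pi complex_eq_iff)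
    finally have "cis (- pi * of_int (1 - j)) = - cis (- pi * of_int j)" .
    moreover have "g (of_int (1 - j) - 1/2) = g (of_int j - 1/2)"
      using even[of "of_int j - 1/2"] by simp
    ultimately show ?thesis
      by (simp add: zak_term_def)
  qed
  then have "(\<Sum>\<^sub>\<infinity>j. - zak_term g (1/2) 0 j) = (\<Sum>\<^sub>\<infinity>j. zak_term g (1/2) 0 (1 - j))"
    by simp
  also have "\<dots> = (\<Sum>\<^sub>\<infinity>j. zak_term g (1/2) 0 j)"
    by (rule infsum_reindex_bij_witness[of _ "\<lambda>j. 1 - j" "\<lambda>j. 1 - j"]) auto
  finally show ?thesis
    by (simp add: infsum_uminus)
qed

theorem mainTheorem1:
  fixes m :: nat
  shows "\<not> is_gabor_frame (hermite_fun (4 * m + 2)) (int_lattice \<union> half_int_lattice)"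
proof -
  obtain C where "decaying_window (hermite_fun (4 * m + 2)) C"
    using decaying_window_hermite by blast
  then interpret decaying_window "hermite_fun (4 * m + 2)" C .
  have "hermite_fun (4 * m + 2) (- t) = hermite_fun (4 * m + 2) t" for t
    by (simp add: hermite_fun_eq herm_minus)
  then show ?thesis
    by (intro not_gabor_frame hermite_zak_at_origin even_zak_at_half)
qed

end
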